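(* Let $T>0$ and $\alpha\in\mathbb{R}$ be fixed such that $\alpha\neq 1$. There does not exist an Ornstein-Uhlenbeck type process $(Z_t)_{t\geq 0}$ (given by the SDE $\mathrm{d}Z_t=q(t)Z_t\,\mathrm{d}t+\sigma(t)\,\mathrm{d}B_t$, $t\ge0$, with $q,\sigma$ as in the context) such that the law of the Ornstein-Uhlenbeck type bridge from $0$ to $0$ over $[0,T]$ derived from $Z$ coincides with the law of the $\alpha$-Wiener bridge.
   Context: Ornstein-Uhlenbeck type process: the strong solution $(Z_t)_{t\ge0}$ of $\mathrm{d}Z_t=q(t)Z_t\,\mathrm{d}t+\sigma(t)\,\mathrm{d}B_t$, $t\ge 0$, where $q:[0,\infty)\to\mathbb{R}$ and $\sigma:[0,\infty)\to\mathbb{R}$ are continuous functions with $\sigma(t)\neq0$ for all $t\ge0$, $(B_t)_{t\ge0}$ is a one-dimensional standard Wiener process, and the initial value $Z_0$ has a Gauss (Gaussian, possibly degenerate) distribution and is independent of $B$. Put $\bar q(t):=\int_0^t q(u)\,\mathrm{d}u$ and $\gamma(s,t):=\int_s^t e^{2(\bar q(t)-\bar q(u))}\sigma^2(u)\,\mathrm{d}u$ for $0\le s\le t$. The bridge of Ornstein-Uhlenbeck type from $0$ to $0$ over $[0,T]$ derived from $Z$ is the process $$U_t=\int_0^t\frac{\gamma(t,T)}{\gamma(s,T)}e^{\bar q(t)-\bar q(s)}\sigma(s)\,\mathrm{d}B_s,\quad t\in[0,T),\qquad U_T=0,$$ which is an almost surely continuous Gauss process on $[0,T]$, or more generally any almost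 surely continuous process on $[0,T]$ having the same finite-dimensional distributions. For $\alpha\in\mathbb{R}$, the $\alpha$-Wiener bridge is the unique strong solution $(X_t)_{t\in[0,T)}$ of $\mathrm{d}X_t=-\frac{\alpha}{T-t}X_t\,\mathrm{d}t+\mathrm{d}B_t$, $t\in[0,T)$, $X_0=0$, namely $X_t=\int_0^t\left(\frac{T-t}{T-s}\right)^{\alpha}\mathrm{d}B_s$, $t\in[0,T)$, or more generally any almost surely continuous process on $[0,T)$ with the same finite-dimensional distributions. The laws of the bridge and of the $\alpha$-Wiener bridge coincide if the two processes have the same finite-dimensional distributions on $[0,T)$. *)

theory Defs
  imports "HOL-Probability.Probability"
begin

definition stochastic_process :: "'a measure \<Rightarrow> real set \<Rightarrow> (real \<Rightarrow> 'a \<Rightarrow> real) \<Rightarrow> bool" where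
  "stochastic_process M I X \<longleftrightarrow> prob_space M \<and> (\<forall>t\<in>I. X t \<in> borel_measurable M)"

definition as_continuous :: "'a measure \<Rightarrow> real set \<Rightarrow> (real \<Rightarrow> 'a \<Rightarrow> real) \<Rightarrow> bool" where
  "as_continuous M I X \<longleftrightarrow> (AE \<omega> in M. continuous_on I (\<lambda>t. X t \<omega>))"

text \<open>The two processes may live on different probability spaces.\<close>

definition same_fdd ::
  "real set \<Rightarrow> 'a measure \<Rightarrow> (real \<Rightarrow> 'a \<Rightarrow> real) \<Rightarrow> 'b measure \<Rightarrow> (real \<Rightarrow> 'b \<Rightarrow> real) \<Rightarrow> bool" where
  "same_fdd I M X N Y \<longleftrightarrow>
     (\<forall>J. finite J \<longrightarrow> J \<subseteq> I \<longrightarrow>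
        distr M (Pi\<^sub>M J (\<lambda>_. borel)) (\<lambda>\<omega>. \<lambda>t\<in>J. X t \<omega>) =
        distr N (Pi\<^sub>M J (\<lambda>_. borel)) (\<lambda>\<omega>. \<lambda>t\<in>J. Y t \<omega>))"

text \<open>The second disjunct is the degenerate case of variance zero.\<close>

definition gaussian_rv :: "'a measure \<Rightarrow> ('a \<Rightarrow> real) \<Rightarrow> bool" where
  "gaussian_rv M X \<longleftrightarrow> X \<in> borel_measurable M \<and>
     ((\<exists>\<mu> s. s > 0 \<and> distributed M lborel X (\<lambda>x. ennreal (normal_density \<mu> s x))) \<or>
      (\<exists>c. AE \<omega> in M. X \<omega> = c))"

text \<open>The second parameter of \<^const>\<open>normal_density\<close> is the standard deviation.\<close>

definition wiener_process :: "'a measure \<Rightarrow> (real \<Rightarrow> 'a \<Rightarrow> real) \<Rightarrow> bool" where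
  "wiener_process M B \<longleftrightarrow>
     stochastic_process M {0..} B \<and>
     (AE \<omega> in M. B 0 \<omega> = 0) \<and>
     (\<forall>s t. 0 \<le> s \<longrightarrow> s < t \<longrightarrow>
        distributed M lborel (\<lambda>\<omega>. B t \<omega> - B s \<omega>)
          (\<lambda>x. ennreal (normal_density 0 (sqrt (t - s)) x))) \<and>
     (\<forall>(n::nat) \<tau>. 0 \<le> \<tau> 0 \<longrightarrow> (\<forall>i<n. \<tau> i \<le> \<tau> (Suc i)) \<longrightarrow>
        prob_space.indep_vars M (\<lambda>_. borel) (\<lambda>i \<omega>. B (\<tau> (Suc i)) \<omega> - B (\<tau> i) \<omega>) {..<n}) \<and>
     as_continuous M {0..} B"

text \<open>
  A list of triples \<open>(c, u, v)\<close> encodes the step function that is the sum of the functions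
  \<open>c\<close> times the indicator of \<open>(u, v]\<close>; the intervals may overlap.
\<close>

definition step_fun :: "(real \<times> real \<times> real) list \<Rightarrow> real \<Rightarrow> real" where
  "step_fun xs s = (\<Sum>(c, u, v)\<leftarrow>xs. c * indicator {u<..v} s)"

definition steps_within :: "real \<Rightarrow> (real \<times> real \<times> real) list \<Rightarrow> bool" where
  "steps_within t xs \<longleftrightarrow> (\<forall>(c, u, v)\<in>set xs. 0 \<le> u \<and> u \<le> v \<and> v \<le> t)"

definition step_integral :: "(real \<Rightarrow> 'a \<Rightarrow> real) \<Rightarrow> (real \<times> real \<times> real) list \<Rightarrow> 'a \<Rightarrow> real" where
  "step_integral B xs \<omega> = (\<Sum>(c, u, v)\<leftarrow>xs. c * (B v \<omega> - B u \<omega>))"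

text \<open>
  \<open>Y\<close> is a version of the stochastic integral of the deterministic function \<open>f\<close> against \<open>B\<close>
  over \<open>[0, t]\<close>: the \<open>L\<^sup>2\<close> limit of the integrals of step functions approximating \<open>f\<close> in
  \<open>L\<^sup>2[0, t]\<close>.  By the Ito isometry the limit does not depend on the approximating sequence,
  up to almost sure equality.  The \<open>L\<^sup>2\<close> distances are nonnegative integrals, so their
  convergence to zero already forces \<open>f\<close> and \<open>Y\<close> to be square integrable.
\<close>

definition has_wiener_integral ::
  "'a measure \<Rightarrow> (real \<Rightarrow> 'a \<Rightarrow> real) \<Rightarrow> real \<Rightarrow> (real \<Rightarrow> real) \<Rightarrow> ('a \<Rightarrow> real) \<Rightarrow> bool" where
  "has_wiener_integral M B t f Y \<longleftrightarrow>
     set_borel_measurable lborel {0..t} f \<and> Y \<in> borel_measurable M \<and>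
     (\<exists>xs. (\<forall>n::nat. steps_within t (xs n)) \<and>
        (\<lambda>n. \<integral>\<^sup>+s\<in>{0..t}. ennreal ((f s - step_fun (xs n) s)\<^sup>2) \<partial>lborel) \<longlonglongrightarrow> 0 \<and>
        (\<lambda>n. \<integral>\<^sup>+\<omega>. ennreal ((Y \<omega> - step_integral B (xs n) \<omega>)\<^sup>2) \<partial>M) \<longlonglongrightarrow> 0)"

text \<open>
  The sigma-algebra at time \<open>t\<close> of the filtration generated by the initial value \<open>\<xi>\<close> and the
  driving process \<open>B\<close>, augmented by the null sets.
\<close>

definition augmented_history ::
  "'a measure \<Rightarrow> ('a \<Rightarrow> real) \<Rightarrow> (real \<Rightarrow> 'a \<Rightarrow> real) \<Rightarrow> real \<Rightarrow> 'a measure" where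
  "augmented_history M \<xi> B t = sigma (space M)
     ({\<xi> -` A \<inter> space M |A. A \<in> sets borel} \<union>
      {B s -` A \<inter> space M |s A. 0 \<le> s \<and> s \<le> t \<and> A \<in> sets borel} \<union>
      null_sets M)"

text \<open>
  Strong solution on the time interval \<open>I\<close> (with left end point 0) of
  \<open>dZ\<^sub>t = a(t) Z\<^sub>t dt + \<sigma>(t) dB\<^sub>t\<close> with initial value \<open>Z\<^sub>0\<close>.
\<close>

definition strong_solution ::
  "'a measure \<Rightarrow> (real \<Rightarrow> 'a \<Rightarrow> real) \<Rightarrow> real set \<Rightarrow> (real \<Rightarrow> real) \<Rightarrow> (real \<Rightarrow> real) \<Rightarrow>
     (real \<Rightarrow> 'a \<Rightarrow> real) \<Rightarrow> bool" where
  "strong_solution M B I a \<sigma> Z \<longleftrightarrow>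
     stochastic_process M I Z \<and>
     (\<forall>t\<in>I. Z t \<in> borel_measurable (augmented_history M (Z 0) B t)) \<and>
     as_continuous M I Z \<and>
     (\<forall>t\<in>I. \<exists>Y. has_wiener_integral M B t \<sigma> Y \<and>
        (AE \<omega> in M. Z t \<omega> = Z 0 \<omega> + integral {0..t} (\<lambda>u. a u * Z u \<omega>) + Y \<omega>))"

definition ou_type_process ::
  "(real \<Rightarrow> real) \<Rightarrow> (real \<Rightarrow> real) \<Rightarrow> 'a measure \<Rightarrow> (real \<Rightarrow> 'a \<Rightarrow> real) \<Rightarrow>
     (real \<Rightarrow> 'a \<Rightarrow> real) \<Rightarrow> bool" where
  "ou_type_process q \<sigma> M B Z \<longleftrightarrow>
     continuous_on {0..} q \<and> continuous_on {0..} \<sigma> \<and> (\<forall>t\<ge>0. \<sigma> t \<noteq> 0) \<and>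
     wiener_process M B \<and>
     gaussian_rv M (Z 0) \<and>
     prob_space.indep_set M
       {Z 0 -` A \<inter> space M |A. A \<in> sets borel}
       (sigma_sets (space M) {B s -` A \<inter> space M |s A. 0 \<le> s \<and> A \<in> sets borel}) \<and>
     strong_solution M B {0..} q \<sigma> Z"

definition qbar :: "(real \<Rightarrow> real) \<Rightarrow> real \<Rightarrow> real" where
  "qbar q t = integral {0..t} q"

definition ou_gamma :: "(real \<Rightarrow> real) \<Rightarrow> (real \<Rightarrow> real) \<Rightarrow> real \<Rightarrow> real \<Rightarrow> real" where
  "ou_gamma q \<sigma> s t = integral {s..t} (\<lambda>u. exp (2 * (qbar q t - qbar q u)) * (\<sigma> u)\<^sup>2)"

text \<open>
  \<open>U\<close>, living on \<open>N\<close>, is a bridge from 0 to 0 over \<open>[0, T]\<close> derived from the process with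
  coefficients \<open>q\<close>, \<open>\<sigma>\<close> driven by \<open>B\<close> on \<open>M\<close>: an almost surely continuous process with the
  finite-dimensional distributions of the integral representation \<open>V\<close>.
\<close>

definition ou_bridge ::
  "(real \<Rightarrow> real) \<Rightarrow> (real \<Rightarrow> real) \<Rightarrow> 'a measure \<Rightarrow> (real \<Rightarrow> 'a \<Rightarrow> real) \<Rightarrow> real \<Rightarrow>
     'b measure \<Rightarrow> (real \<Rightarrow> 'b \<Rightarrow> real) \<Rightarrow> bool" where
  "ou_bridge q \<sigma> M B T N U \<longleftrightarrow>
     stochastic_process N {0..T} U \<and> as_continuous N {0..T} U \<and>
     (\<exists>V. (\<forall>t\<in>{0..<T}. has_wiener_integral M B t
              (\<lambda>s. ou_gamma q \<sigma> t T / ou_gamma q \<sigma> s T * exp (qbar q t - qbar q s) * \<sigma> s) (V t)) \<and>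
          V T = (\<lambda>_. 0) \<and>
          same_fdd {0..T} M V N U)"

text \<open>
  \<open>X\<close>, living on \<open>N\<close>, is an almost surely continuous process with the finite-dimensional
  distributions of the strong solution \<open>Y\<close> of
  \<open>dY\<^sub>t = - \<alpha> / (T - t) Y\<^sub>t dt + dB\<^sub>t\<close>, \<open>Y\<^sub>0 = 0\<close>, on \<open>[0, T)\<close>, where \<open>B\<close> is a Wiener process
  on \<open>M\<close>.
\<close>

definition alpha_wiener_bridge ::
  "real \<Rightarrow> real \<Rightarrow> 'a measure \<Rightarrow> (real \<Rightarrow> 'a \<Rightarrow> real) \<Rightarrow> 'b measure \<Rightarrow>
     (real \<Rightarrow> 'b \<Rightarrow> real) \<Rightarrow> bool" where
  "alpha_wiener_bridge \<alpha> T M B N X \<longleftrightarrow>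
     wiener_process M B \<and>
     stochastic_process N {0..<T} X \<and> as_continuous N {0..<T} X \<and>
     (\<exists>Y. strong_solution M B {0..<T} (\<lambda>t. - (\<alpha> / (T - t))) (\<lambda>_. 1) Y \<and>
          (AE \<omega> in M. Y 0 \<omega> = 0) \<and>
          same_fdd {0..<T} M Y N X)"

end

theory Submission
  imports Defs
begin

text \<open>
  By the Ito isometry both processes have covariances of the form \<open>h(s) h(t) K(s)\<close> for
  \<open>s \<le> t\<close>, with \<open>h(t) = \<gamma>(t, T) exp (qbar t)\<close> for the bridge and \<open>h(t) = (T - t)\<^sup>\<alpha>\<close> for the
  \<open>\<alpha>\<close>-Wiener bridge.  Equality of the laws makes these two functions proportional on
  \<open>[T/2, T)\<close>.  But \<open>\<gamma>(t, T) / (T - t)\<close> tends to \<open>\<sigma>(T)\<^sup>2 > 0\<close> as \<open>t\<close> increases to \<open>T\<close>, which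
  forces \<open>\<alpha> = 1\<close>.
\<close>

subsection \<open>Products of \<open>L\<^sup>2\<close> limits\<close>

text \<open>The obstacle is that the \<alpha>-Wiener bridge is given by an equation, not by an
  integral: the equation holds at each time only almost surely, and its noise term is known only as
  some \<open>L^2\<close> limit. Before the isometry can apply, the solution has to be recognised as
  the Wiener integral of its kernel. This is done path by path: the linear integral equation is
  solved by an integrating factor, which involves only ordinary integrals of the continuous path of
  \<open>B\<close>, and the resulting formula is exactly what integration by parts turns the Wiener
  integral into. Proportionality comes from freezing the earlier time at \<open>T / 2\<close>, since
  the covariance then depends on the later time through \<open>h\<close> alone. Of the two constants
  in that relation only the one on the \<alpha>-Wiener side is shown to be nonzero; a vanishing
  constant on the other side would contradict it at once.\<close>

lemma integrable_mult_of_squares: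
  fixes F G :: "'a \<Rightarrow> real"
  assumes [measurable]: "F \<in> borel_measurable M" "G \<in> borel_measurable M"
    and "integrable M (\<lambda>x. (F x)\<^sup>2)" "integrable M (\<lambda>x. (G x)\<^sup>2)"
  shows "integrable M (\<lambda>x. F x * G x)"
proof (rule Bochner_Integration.integrable_bound)
  show "integrable M (\<lambda>x. (F x)\<^sup>2 + (G x)\<^sup>2)"
    using assms by simp
  show "AE x in M. norm (F x * G x) \<le> norm ((F x)\<^sup>2 + (G x)\<^sup>2)"
  proof (rule AE_I2)
    fix x
    have "2 * \<bar>F x * G x\<bar> \<le> (F x)\<^sup>2 + (G x)\<^sup>2"
      using sum_squares_bound[of "\<bar>F x\<bar>" "\<bar>G x\<bar>"] by (simp add: abs_mult)
    then show "norm (F x * G x) \<le> norm ((F x)\<^sup>2 + (G x)\<^sup>2)"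
      using abs_ge_zero[of "F x * G x"] unfolding real_norm_def by linarith
  qed
qed simp

lemma integrable_square_diff:
  fixes F G :: "'a \<Rightarrow> real"
  assumes [measurable]: "F \<in> borel_measurable M" "G \<in> borel_measurable M"
    and "integrable M (\<lambda>x. (F x)\<^sup>2)" "integrable M (\<lambda>x. (G x)\<^sup>2)"
  shows "integrable M (\<lambda>x. (F x - G x)\<^sup>2)"
  using assms integrable_mult_of_squares[OF assms]
  by (simp add: power2_diff mult.assoc)

lemma integrable_square_of_diff:
  fixes F G :: "'a \<Rightarrow> real"
  assumes [measurable]: "F \<in> borel_measurable M" "G \<in> borel_measurable M"
    and "integrable M (\<lambda>x. (G x)\<^sup>2)" "integrable M (\<lambda>x. (F x - G x)\<^sup>2)"
  shows "integrable M (\<lambda>x. (F x)\<^sup>2)"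
  using integrable_square_diff[of "\<lambda>x. F x - G x" M "\<lambda>x. - G x"] assms by simp

text \<open>Some distance is below 1, hence finite, so \<open>F\<close> differs from a square
  integrable function by a square integrable one. Only then can all the distances be read as real
  integrals.\<close>

lemma L2_limit_square_integrable:
  fixes F :: "'a \<Rightarrow> real" and Fn :: "nat \<Rightarrow> 'a \<Rightarrow> real"
  assumes [measurable]: "F \<in> borel_measurable M" "\<And>n. Fn n \<in> borel_measurable M"
    and Fn: "\<And>n. integrable M (\<lambda>x. (Fn n x)\<^sup>2)"
    and lim: "(\<lambda>n. \<integral>\<^sup>+x. ennreal ((F x - Fn n x)\<^sup>2) \<partial>M) \<longlonglongrightarrow> 0"
  shows "integrable M (\<lambda>x. (F x)\<^sup>2)"
    and "(\<lambda>n. \<integral>x. (F x - Fn n x)\<^sup>2 \<partial>M) \<longlonglongrightarrow> 0"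
proof -
  have "eventually (\<lambda>n. (\<integral>\<^sup>+x. ennreal ((F x - Fn n x)\<^sup>2) \<partial>M) < 1) sequentially"
    using lim by (rule order_tendstoD) simp
  then obtain n where n: "(\<integral>\<^sup>+x. ennreal ((F x - Fn n x)\<^sup>2) \<partial>M) < 1"
    by (auto simp: eventually_sequentially)
  have "integrable M (\<lambda>x. (F x - Fn n x)\<^sup>2)"
    using n by (intro integrableI_nonneg) (auto intro: order.strict_trans)
  then show F: "integrable M (\<lambda>x. (F x)\<^sup>2)"
    by (rule integrable_square_of_diff[OF _ _ Fn, rotated 2]) auto
  have D: "integrable M (\<lambda>x. (F x - Fn n x)\<^sup>2)" for n
    by (rule integrable_square_diff[OF _ _ F Fn]) auto
  have eq: "(\<integral>\<^sup>+x. ennreal ((F x - Fn n x)\<^sup>2) \<partial>M) = ennreal (\<integral>x. (F x - Fn n x)\<^sup>2 \<partial>M)" for n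
    by (rule nn_integral_eq_integral[OF D]) auto
  have "(\<lambda>n. ennreal (\<integral>x. (F x - Fn n x)\<^sup>2 \<partial>M)) \<longlonglongrightarrow> ennreal 0"
    using lim unfolding eq by simp
  then show "(\<lambda>n. \<integral>x. (F x - Fn n x)\<^sup>2 \<partial>M) \<longlonglongrightarrow> 0"
    by (subst (asm) tendsto_ennreal_iff) auto
qed

text \<open>Integrated pointwise and with a well chosen weight \<open>c\<close>, this takes the
  place of the Cauchy-Schwarz inequality.\<close>

lemma young_abs_le:
  fixes a b c :: real
  assumes "c > 0"
  shows "2 * \<bar>a * b\<bar> \<le> c * a\<^sup>2 + b\<^sup>2 / c"
proof -
  have "0 \<le> (c * \<bar>a\<bar> - \<bar>b\<bar>)\<^sup>2 / c"
    using assms by simp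
  also have "\<dots> = c * a\<^sup>2 + b\<^sup>2 / c - 2 * \<bar>a * b\<bar>"
    using assms by (simp add: power2_eq_square field_simps abs_mult)
  finally show ?thesis by simp
qed

lemma L2_limit_integral_mult:
  fixes F G :: "'a \<Rightarrow> real" and Fn Gn :: "nat \<Rightarrow> 'a \<Rightarrow> real"
  assumes [measurable]: "F \<in> borel_measurable M" "\<And>n. Fn n \<in> borel_measurable M"
      "G \<in> borel_measurable M" "\<And>n. Gn n \<in> borel_measurable M"
    and Fn: "\<And>n. integrable M (\<lambda>x. (Fn n x)\<^sup>2)" and Gn: "\<And>n. integrable M (\<lambda>x. (Gn n x)\<^sup>2)"
    and limF: "(\<lambda>n. \<integral>\<^sup>+x. ennreal ((F x - Fn n x)\<^sup>2) \<partial>M) \<longlonglongrightarrow> 0"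
    and limG: "(\<lambda>n. \<integral>\<^sup>+x. ennreal ((G x - Gn n x)\<^sup>2) \<partial>M) \<longlonglongrightarrow> 0"
  shows "(\<lambda>n. \<integral>x. Fn n x * Gn n x \<partial>M) \<longlonglongrightarrow> (\<integral>x. F x * G x \<partial>M)"
proof -
  note F = L2_limit_square_integrable[OF assms(1,2) Fn limF]
  note G = L2_limit_square_integrable[OF assms(3,4) Gn limG]
  define a where "a n = (\<integral>x. (F x - Fn n x)\<^sup>2 \<partial>M)" for n
  define b where "b n = (\<integral>x. (G x - Gn n x)\<^sup>2 \<partial>M)" for n
  define A where "A = (\<integral>x. (F x)\<^sup>2 \<partial>M)"
  define B where "B = (\<integral>x. (G x)\<^sup>2 \<partial>M)"
  define s where "s n = a n + b n" for n
  define e where "e n = (sqrt (s n) + 1 / Suc n) * (A + B) + sqrt (s n) + s n" for n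
  have ab0: "a n \<ge> 0" "b n \<ge> 0" for n by (auto simp: a_def b_def)
  have dF: "integrable M (\<lambda>x. (F x - Fn n x)\<^sup>2)" for n
    by (rule integrable_square_diff) (use F Fn in auto)
  have dG: "integrable M (\<lambda>x. (G x - Gn n x)\<^sup>2)" for n
    by (rule integrable_square_diff) (use G Gn in auto)
  have iFG: "integrable M (\<lambda>x. F x * G x)"
    by (rule integrable_mult_of_squares) (use F G in auto)
  have iFGn: "integrable M (\<lambda>x. Fn n x * Gn n x)" for n
    by (rule integrable_mult_of_squares) (use Fn Gn in auto)
  have bound: "\<bar>(\<integral>x. Fn n x * Gn n x \<partial>M) - (\<integral>x. F x * G x \<partial>M)\<bar> \<le> e n" for n
  proof -
    \<comment> \<open>This weight balances \<open>c * (A + B)\<close> against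
      \<open>s n / c\<close>: both become of order \<open>sqrt (s n)\<close>. The summand
      \<open>1 / Suc n\<close> keeps \<open>c\<close> positive when \<open>s n = 0\<close>.\<close>
    define c where "c = sqrt (s n) + 1 / Suc n"
    have s0: "s n \<ge> 0" using ab0 by (simp add: s_def)
    have c0: "c > 0" using s0 by (simp add: c_def add_nonneg_pos)
    have pw: "\<bar>Fn n x * Gn n x - F x * G x\<bar> \<le>
       c * (F x)\<^sup>2 + (G x - Gn n x)\<^sup>2 / c + (c * (G x)\<^sup>2 + (F x - Fn n x)\<^sup>2 / c)
       + ((F x - Fn n x)\<^sup>2 + (G x - Gn n x)\<^sup>2)" (is "_ \<le> ?r x") for x
    proof -
      have "Fn n x * Gn n x - F x * G x =
        (F x - Fn n x) * (G x - Gn n x) - F x * (G x - Gn n x) - G x * (F x - Fn n x)"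
        by (simp add: algebra_simps)
      moreover have "2 * \<bar>(F x - Fn n x) * (G x - Gn n x)\<bar> \<le> (F x - Fn n x)\<^sup>2 + (G x - Gn n x)\<^sup>2"
        using young_abs_le[of 1 "F x - Fn n x" "G x - Gn n x"] by simp
      ultimately show ?thesis
        using young_abs_le[OF c0, of "F x" "G x - Gn n x"]
          young_abs_le[OF c0, of "G x" "F x - Fn n x"] by linarith
    qed
    have "\<bar>(\<integral>x. Fn n x * Gn n x \<partial>M) - (\<integral>x. F x * G x \<partial>M)\<bar>
        = \<bar>\<integral>x. Fn n x * Gn n x - F x * G x \<partial>M\<bar>"
      using iFG iFGn by simp
    also have "\<dots> \<le> (\<integral>x. \<bar>Fn n x * Gn n x - F x * G x\<bar> \<partial>M)"
      by (rule integral_abs_bound)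
    also have "\<dots> \<le> (\<integral>x. ?r x \<partial>M)"
      by (rule integral_mono) (use pw dF dG F G iFG iFGn in auto)
    also have "\<dots> = c * A + b n / c + (c * B + a n / c) + (a n + b n)"
      using dF dG F G by (simp add: A_def B_def a_def b_def)
    also have "\<dots> = c * (A + B) + s n / c + s n"
      by (simp add: s_def algebra_simps add_divide_distrib)
    also have "s n / c \<le> sqrt (s n)"
    proof -
      have "s n = sqrt (s n) * sqrt (s n)" using s0 by simp
      also have "\<dots> \<le> sqrt (s n) * c"
        using s0 by (intro mult_left_mono) (auto simp: c_def)
      finally show ?thesis using c0 by (simp add: field_simps)
    qed
    finally show ?thesis by (simp add: e_def c_def)
  qed
  have "s \<longlonglongrightarrow> 0"
    using tendsto_add[OF F(2) G(2)] by (simp add: s_def[abs_def] a_def b_def)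
  moreover have "(\<lambda>n. 1 / real (Suc n)) \<longlonglongrightarrow> 0"
    using LIMSEQ_inverse_real_of_nat by (simp add: field_simps)
  ultimately have "e \<longlonglongrightarrow> (sqrt 0 + 0) * (A + B) + sqrt 0 + 0"
    unfolding e_def[abs_def] by (intro tendsto_intros)
  then have "e \<longlonglongrightarrow> 0" by simp
  then have "(\<lambda>n. (\<integral>x. Fn n x * Gn n x \<partial>M) - (\<integral>x. F x * G x \<partial>M)) \<longlonglongrightarrow> 0"
    by (rule Lim_null_comparison[rotated]) (use bound in \<open>auto intro!: always_eventually\<close>)
  then show ?thesis by (simp add: LIM_zero_iff)
qed

subsection \<open>The Ito isometry for deterministic integrands\<close>

lemma wiener_measurable: "wiener_process M B \<Longrightarrow> 0 \<le> t \<Longrightarrow> B t \<in> borel_measurable M"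
  by (simp add: wiener_process_def stochastic_process_def)

text \<open>The absolute value admits the end points in either order, as polarization needs for
  intervals in arbitrary relative position.\<close>

lemma wiener_increment_square:
  assumes W: "wiener_process M B" and "0 \<le> u" "0 \<le> v"
  shows "has_bochner_integral M (\<lambda>\<omega>. (B v \<omega> - B u \<omega>)\<^sup>2) \<bar>v - u\<bar>"
proof -
  have *: "has_bochner_integral M (\<lambda>\<omega>. (B t \<omega> - B s \<omega>)\<^sup>2) (t - s)" if "0 \<le> s" "s < t" for s t
  proof -
    have D: "distributed M lborel (\<lambda>\<omega>. B t \<omega> - B s \<omega>)
          (\<lambda>x. ennreal (normal_density 0 (sqrt (t - s)) x))"
      using W that by (simp add: wiener_process_def)
    have pos: "0 < sqrt (t - s)" using that by simp
    note m = normal_moment_even[OF pos, of 0 1]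
    have "integrable M (\<lambda>\<omega>. (B t \<omega> - B s \<omega>)\<^sup>2)"
      using distributed_integrable[OF D, of "\<lambda>x. x\<^sup>2"] has_bochner_integral_iff m by auto
    moreover have "(\<integral>\<omega>. (B t \<omega> - B s \<omega>)\<^sup>2 \<partial>M) = t - s"
      using distributed_integral[OF D, of "\<lambda>x. x\<^sup>2"] integral_normal_moment_even[OF pos, of 0 1] that
      by simp
    ultimately show ?thesis by (simp add: has_bochner_integral_iff)
  qed
  consider "u < v" | "v < u" | "u = v" by linarith
  then show ?thesis
  proof cases
    case 1 then show ?thesis using *[of u v] assms by simp
  next
    case 2 then show ?thesis using *[of v u] assms by (simp add: power2_commute)
  next
    case 3 then show ?thesis by (simp add: has_bochner_integral_zero)
  qed
qed

text \<open>By polarization only the variances of the increments enter.\<close>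

lemma wiener_increment_mult:
  assumes W: "wiener_process M B" and "0 \<le> u" "u \<le> v" "0 \<le> u'" "u' \<le> v'"
  shows "has_bochner_integral M (\<lambda>\<omega>. (B v \<omega> - B u \<omega>) * (B v' \<omega> - B u' \<omega>))
     (max 0 (min v v' - max u u'))"
proof -
  have "has_bochner_integral M
      (\<lambda>\<omega>. ((B v \<omega> - B u' \<omega>)\<^sup>2 + (B v' \<omega> - B u \<omega>)\<^sup>2 - (B v \<omega> - B v' \<omega>)\<^sup>2 - (B u \<omega> - B u' \<omega>)\<^sup>2) / 2)
      ((\<bar>v - u'\<bar> + \<bar>v' - u\<bar> - \<bar>v - v'\<bar> - \<bar>u - u'\<bar>) / 2)"
    by (intro has_bochner_integral_divide_zero has_bochner_integral_add has_bochner_integral_diff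
        wiener_increment_square[OF W]) (use assms in auto)
  also have "(\<lambda>\<omega>. ((B v \<omega> - B u' \<omega>)\<^sup>2 + (B v' \<omega> - B u \<omega>)\<^sup>2 - (B v \<omega> - B v' \<omega>)\<^sup>2 - (B u \<omega> - B u' \<omega>)\<^sup>2) / 2)
     = (\<lambda>\<omega>. (B v \<omega> - B u \<omega>) * (B v' \<omega> - B u' \<omega>))"
    by (auto simp: power2_eq_square field_simps)
  also have "(\<bar>v - u'\<bar> + \<bar>v' - u\<bar> - \<bar>v - v'\<bar> - \<bar>u - u'\<bar>) / 2 = max 0 (min v v' - max u u')"
    using assms by (auto simp: max_def min_def abs_if)
  finally show ?thesis .
qed

text \<open>The value is the length of the overlap, the same number as for the product of the two
  increments. This agreement is the isometry for single intervals.\<close>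

lemma indicator_Ioc_mult:
  fixes u v u' v' :: real
  assumes "u \<le> v" "u' \<le> v'"
  shows "has_bochner_integral lborel (\<lambda>s. indicator {u<..v} s * indicator {u'<..v'} s :: real)
     (max 0 (min v v' - max u u'))"
proof -
  have "has_bochner_integral lborel (indicator ({u<..v} \<inter> {u'<..v'}) :: real \<Rightarrow> real)
     (measure lborel ({u<..v} \<inter> {u'<..v'}))"
    by (rule has_bochner_integral_real_indicator)
      (auto simp: Int_greaterThanAtMost simp flip: infinity_ennreal_def intro!: emeasure_bounded_finite)
  moreover have "measure lborel ({u<..v} \<inter> {u'<..v'}) = max 0 (min v v' - max u u')"
    by (auto simp: Int_greaterThanAtMost max_def min_def)
  moreover have "(\<lambda>s. indicator {u<..v} s * indicator {u'<..v'} s) = (indicator ({u<..v} \<inter> {u'<..v'}) :: real \<Rightarrow> real)"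
    by (auto simp: fun_eq_iff indicator_def)
  ultimately show ?thesis by (simp del: Int_greaterThanAtMost)
qed

section \<open>Step functions and their integrals\<close>

lemma step_fun_simps [simp]:
  "step_fun [] s = 0"
  "step_fun ((c, u, v) # xs) s = c * indicator {u<..v} s + step_fun xs s"
  by (auto simp: step_fun_def)

lemma step_integral_simps [simp]:
  "step_integral B [] \<omega> = 0"
  "step_integral B ((c, u, v) # xs) \<omega> = c * (B v \<omega> - B u \<omega>) + step_integral B xs \<omega>"
  by (auto simp: step_integral_def)

lemma steps_within_simps [simp]:
  "steps_within t []"
  "steps_within t ((c, u, v) # xs) \<longleftrightarrow> 0 \<le> u \<and> u \<le> v \<and> v \<le> t \<and> steps_within t xs"
  by (auto simp: steps_within_def)

lemma step_fun_measurable [measurable]: "step_fun xs \<in> borel_measurable borel"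
proof (induction xs)
  case (Cons x xs) then show ?case by (cases x) (simp cong: measurable_cong)
qed (simp cong: measurable_cong)

lemma step_integral_measurable:
  assumes "wiener_process M B" "steps_within t xs"
  shows "step_integral B xs \<in> borel_measurable M"
  using assms(2)
proof (induction xs)
  case (Cons x xs)
  obtain c u v where x: "x = (c, u, v)" by (cases x)
  have "B u \<in> borel_measurable M" "B v \<in> borel_measurable M"
    using Cons x by (auto intro!: wiener_measurable[OF assms(1)])
  then show ?case using Cons by (simp add: x cong: measurable_cong)
qed (simp cong: measurable_cong)

text \<open>Lets integrals over \<open>{0..t}\<close> be taken over the whole line. The point 0 is
  outside as well, because the intervals are open on the left.\<close>

lemma step_fun_outside:
  assumes "steps_within t xs" "s \<notin> {0<..t}"
  shows "step_fun xs s = 0"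
  using assms
proof (induction xs)
  case (Cons x xs) then show ?case by (cases x) (auto simp: indicator_def)
qed simp

text \<open>The unnamed common value \<open>I\<close> lets the induction carry integrability and
  equality together, with no closed formula for lists of overlapping intervals.\<close>

lemma step_isometry_single:
  assumes W: "wiener_process M B" and u: "0 \<le> u" "u \<le> v" and ys: "steps_within t ys"
  shows "\<exists>I. has_bochner_integral M (\<lambda>\<omega>. (B v \<omega> - B u \<omega>) * step_integral B ys \<omega>) I \<and>
     has_bochner_integral lborel (\<lambda>s. indicator {u<..v} s * step_fun ys s) I"
  using ys
proof (induction ys)
  case Nil
  then show ?case by (intro exI[of _ 0]) (simp add: has_bochner_integral_zero)
next
  case (Cons y ys)
  obtain c p q where y: "y = (c, p, q)" by (cases y)
  from Cons obtain I where I: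
     "has_bochner_integral M (\<lambda>\<omega>. (B v \<omega> - B u \<omega>) * step_integral B ys \<omega>) I"
     "has_bochner_integral lborel (\<lambda>s. indicator {u<..v} s * step_fun ys s) I"
    by (auto simp: y)
  have pq: "0 \<le> p" "p \<le> q" using Cons.prems by (auto simp: y)
  note 1 = has_bochner_integral_add[OF
      has_bochner_integral_mult_right[OF wiener_increment_mult[OF W u pq], of c] I(1)]
  note 2 = has_bochner_integral_add[OF
      has_bochner_integral_mult_right[OF indicator_Ioc_mult[OF u(2) pq(2)], of c] I(2)]
  show ?case
    \<comment> \<open>The witness stays schematic; \<open>1\<close> and \<open>2\<close> end in the
      same value and thereby determine it, and congruence only rearranges the integrands.\<close>
    by (rule exI, rule conjI[OF 1[THEN has_bochner_integral_cong[THEN iffD1, rotated -1]]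
          2[THEN has_bochner_integral_cong[THEN iffD1, rotated -1]]])
      (auto simp: y algebra_simps)
qed

text \<open>Linearity in the first factor, with the second list fixed. The horizons \<open>t\<close>
  and \<open>t'\<close> may differ, since covariances at two different times are wanted.\<close>

lemma step_isometry:
  assumes W: "wiener_process M B" and xs: "steps_within t xs" and ys: "steps_within t' ys"
  shows "\<exists>I. has_bochner_integral M (\<lambda>\<omega>. step_integral B xs \<omega> * step_integral B ys \<omega>) I \<and>
     has_bochner_integral lborel (\<lambda>s. step_fun xs s * step_fun ys s) I"
  using xs
proof (induction xs)
  case Nil
  then show ?case by (intro exI[of _ 0]) (simp add: has_bochner_integral_zero)
next
  case (Cons x xs)
  obtain c u v where x: "x = (c, u, v)" by (cases x)
  from Cons obtain I where I:
     "has_bochner_integral M (\<lambda>\<omega>. step_integral B xs \<omega> * step_integral B ys \<omega>) I"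
     "has_bochner_integral lborel (\<lambda>s. step_fun xs s * step_fun ys s) I"
    by (auto simp: x)
  have u: "0 \<le> u" "u \<le> v" using Cons.prems by (auto simp: x)
  obtain J where J:
     "has_bochner_integral M (\<lambda>\<omega>. (B v \<omega> - B u \<omega>) * step_integral B ys \<omega>) J"
     "has_bochner_integral lborel (\<lambda>s. indicator {u<..v} s * step_fun ys s) J"
    using step_isometry_single[OF W u ys] by blast
  note 1 = has_bochner_integral_add[OF has_bochner_integral_mult_right[OF J(1), of c] I(1)]
  note 2 = has_bochner_integral_add[OF has_bochner_integral_mult_right[OF J(2), of c] I(2)]
  show ?case
    by (rule exI, rule conjI[OF 1[THEN has_bochner_integral_cong[THEN iffD1, rotated -1]]
          2[THEN has_bochner_integral_cong[THEN iffD1, rotated -1]]])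
      (auto simp: x algebra_simps)
qed

text \<open>Both sides are limits of one and the same sequence, by the isometry for steps. Extension
  by zero puts integrands with different horizons into a common \<open>L^2\<close> space over the
  line.\<close>

lemma wiener_integral_isometry:
  assumes W: "wiener_process M B"
    and V: "has_wiener_integral M B s f V" and Y: "has_wiener_integral M B t g Y"
  shows "integrable M (\<lambda>\<omega>. V \<omega> * Y \<omega>)"
    and "(\<integral>\<omega>. V \<omega> * Y \<omega> \<partial>M) = (\<integral>u. (indicator {0..s} u * f u) * (indicator {0..t} u * g u) \<partial>lborel)"
proof -
  define f' where "f' u = indicator {0..s} u * f u" for u
  define g' where "g' u = indicator {0..t} u * g u" for u
  obtain xs where xs: "\<And>n. steps_within s (xs n)"
      "(\<lambda>n. \<integral>\<^sup>+u\<in>{0..s}. ennreal ((f u - step_fun (xs n) u)\<^sup>2) \<partial>lborel) \<longlonglongrightarrow> 0"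
      "(\<lambda>n. \<integral>\<^sup>+\<omega>. ennreal ((V \<omega> - step_integral B (xs n) \<omega>)\<^sup>2) \<partial>M) \<longlonglongrightarrow> 0"
    using V unfolding has_wiener_integral_def by blast
  obtain ys where ys: "\<And>n. steps_within t (ys n)"
      "(\<lambda>n. \<integral>\<^sup>+u\<in>{0..t}. ennreal ((g u - step_fun (ys n) u)\<^sup>2) \<partial>lborel) \<longlonglongrightarrow> 0"
      "(\<lambda>n. \<integral>\<^sup>+\<omega>. ennreal ((Y \<omega> - step_integral B (ys n) \<omega>)\<^sup>2) \<partial>M) \<longlonglongrightarrow> 0"
    using Y unfolding has_wiener_integral_def by blast
  have [measurable]: "V \<in> borel_measurable M" "Y \<in> borel_measurable M"
    using V Y by (auto simp: has_wiener_integral_def)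
  have [measurable]: "f' \<in> borel_measurable lborel" "g' \<in> borel_measurable lborel"
    using V Y by (auto simp: has_wiener_integral_def set_borel_measurable_def f'_def[abs_def] g'_def[abs_def])
  have [measurable]: "step_integral B (xs n) \<in> borel_measurable M"
    "step_integral B (ys n) \<in> borel_measurable M" for n
    using step_integral_measurable[OF W] xs ys by blast+
  have sq: "integrable M (\<lambda>\<omega>. (step_integral B zs \<omega>)\<^sup>2)"
     "integrable lborel (\<lambda>u. (step_fun zs u)\<^sup>2)" if "steps_within r zs" for r zs
    using step_isometry[OF W that that] by (auto simp: power2_eq_square has_bochner_integral_iff)
  have "(\<integral>\<^sup>+u\<in>{0..s}. ennreal ((f u - step_fun (xs n) u)\<^sup>2) \<partial>lborel) =
      (\<integral>\<^sup>+u. ennreal ((f' u - step_fun (xs n) u)\<^sup>2) \<partial>lborel)" for n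
    using step_fun_outside[OF xs(1)]
    by (intro nn_integral_cong) (auto simp: f'_def indicator_def)
  with xs(2) have fl: "(\<lambda>n. \<integral>\<^sup>+u. ennreal ((f' u - step_fun (xs n) u)\<^sup>2) \<partial>lborel) \<longlonglongrightarrow> 0" by simp
  have "(\<integral>\<^sup>+u\<in>{0..t}. ennreal ((g u - step_fun (ys n) u)\<^sup>2) \<partial>lborel) =
      (\<integral>\<^sup>+u. ennreal ((g' u - step_fun (ys n) u)\<^sup>2) \<partial>lborel)" for n
    using step_fun_outside[OF ys(1)]
    by (intro nn_integral_cong) (auto simp: g'_def indicator_def)
  with ys(2) have gl: "(\<lambda>n. \<integral>\<^sup>+u. ennreal ((g' u - step_fun (ys n) u)\<^sup>2) \<partial>lborel) \<longlonglongrightarrow> 0" by simp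
  show "integrable M (\<lambda>\<omega>. V \<omega> * Y \<omega>)"
    by (rule integrable_mult_of_squares)
      (auto intro!: L2_limit_square_integrable(1)[OF _ _ _ xs(3)]
        L2_limit_square_integrable(1)[OF _ _ _ ys(3)] sq xs ys)
  have l1: "(\<lambda>n. \<integral>\<omega>. step_integral B (xs n) \<omega> * step_integral B (ys n) \<omega> \<partial>M) \<longlonglongrightarrow> (\<integral>\<omega>. V \<omega> * Y \<omega> \<partial>M)"
    by (rule L2_limit_integral_mult[OF _ _ _ _ _ _ xs(3) ys(3)]) (auto intro!: sq xs ys)
  have l2: "(\<lambda>n. \<integral>u. step_fun (xs n) u * step_fun (ys n) u \<partial>lborel) \<longlonglongrightarrow> (\<integral>u. f' u * g' u \<partial>lborel)"
    by (rule L2_limit_integral_mult[OF _ _ _ _ _ _ fl gl]) (auto intro!: sq xs ys)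
  have "(\<integral>\<omega>. step_integral B (xs n) \<omega> * step_integral B (ys n) \<omega> \<partial>M) =
      (\<integral>u. step_fun (xs n) u * step_fun (ys n) u \<partial>lborel)" for n
    using step_isometry[OF W xs(1)[of n] ys(1)[of n]] by (auto simp: has_bochner_integral_iff)
  with l1 l2 show "(\<integral>\<omega>. V \<omega> * Y \<omega> \<partial>M) = (\<integral>u. (indicator {0..s} u * f u) * (indicator {0..t} u * g u) \<partial>lborel)"
    unfolding f'_def g'_def by (metis (no_types, lifting) LIMSEQ_unique ext)
qed

text \<open>\<open>V\<close> and \<open>Y\<close> may stem from different approximating sequences,
  yet the three product moments in the expansion of \<open>(V - Y)\<^sup>2\<close> all equal the
  integral of \<open>f\<^sup>2\<close> over \<open>{0..t}\<close> and cancel.\<close>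

lemma has_wiener_integral_unique:
  assumes W: "wiener_process M B"
    and V: "has_wiener_integral M B t f V" and Y: "has_wiener_integral M B t f Y"
  shows "AE \<omega> in M. V \<omega> = Y \<omega>"
proof -
  note VV = wiener_integral_isometry[OF W V V] and VY = wiener_integral_isometry[OF W V Y]
    and YY = wiener_integral_isometry[OF W Y Y]
  have eq: "(V \<omega> - Y \<omega>)\<^sup>2 = V \<omega> * V \<omega> - 2 * (V \<omega> * Y \<omega>) + Y \<omega> * Y \<omega>" for \<omega>
    by (simp add: power2_eq_square algebra_simps)
  have "integrable M (\<lambda>\<omega>. (V \<omega> - Y \<omega>)\<^sup>2)" "(\<integral>\<omega>. (V \<omega> - Y \<omega>)\<^sup>2 \<partial>M) = 0"
    unfolding eq using VV VY YY by simp_all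
  then have "AE \<omega> in M. (V \<omega> - Y \<omega>)\<^sup>2 = 0"
    by (subst (asm) integral_nonneg_eq_0_iff_AE) auto
  then show ?thesis by simp
qed

lemma step_isometry_diff:
  assumes W: "wiener_process M B" and xs: "steps_within t xs" and ys: "steps_within t ys"
  shows "(\<integral>\<^sup>+\<omega>. ennreal ((step_integral B xs \<omega> - step_integral B ys \<omega>)\<^sup>2) \<partial>M) =
    (\<integral>\<^sup>+s. ennreal ((step_fun xs s - step_fun ys s)\<^sup>2) \<partial>lborel)"
proof -
  have eq: "(x - y)\<^sup>2 = x * x - 2 * (x * y) + y * y" for x y :: real
    by (simp add: power2_eq_square algebra_simps)
  note I = step_isometry[OF W xs xs] step_isometry[OF W xs ys] step_isometry[OF W ys ys]
  have "integrable M (\<lambda>\<omega>. (step_integral B xs \<omega> - step_integral B ys \<omega>)\<^sup>2)"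
    "integrable lborel (\<lambda>s. (step_fun xs s - step_fun ys s)\<^sup>2)"
    "(\<integral>\<omega>. (step_integral B xs \<omega> - step_integral B ys \<omega>)\<^sup>2 \<partial>M) =
      (\<integral>s. (step_fun xs s - step_fun ys s)\<^sup>2 \<partial>lborel)"
    unfolding eq using I by (auto simp: has_bochner_integral_iff)
  then show ?thesis
    by (simp add: nn_integral_eq_integral)
qed

subsection \<open>Integration by parts\<close>

text \<open>A uniform error \<open>e\<close> of approximating step functions produces a squared
  distance of order \<open>e\<^sup>2\<close>; this is the shape of both estimates in the integration
  by parts.\<close>

lemma ennreal_tendsto_0_quadratic:
  fixes x :: "nat \<Rightarrow> ennreal" and K :: real
  assumes K: "K > 0" and *: "\<And>e. e > 0 \<Longrightarrow> \<exists>N. \<forall>n\<ge>N. x n \<le> ennreal (K * e\<^sup>2)"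
  shows "x \<longlonglongrightarrow> 0"
proof (rule order_tendstoI)
  fix a :: ennreal assume "0 < a"
  have "\<exists>d::real>0. ennreal d < a"
  proof (cases a)
    case (real r)
    then show ?thesis using \<open>0 < a\<close>
      by (intro exI[of _ "r / 2"]) (auto simp: ennreal_less_iff)
  next
    case top
    then show ?thesis by (intro exI[of _ 1]) auto
  qed
  then obtain d :: real where d: "0 < d" "ennreal d < a" by blast
  obtain N where "\<forall>n\<ge>N. x n \<le> ennreal (K * (sqrt (d / K))\<^sup>2)"
    using *[of "sqrt (d / K)"] d K by auto
  then have "\<forall>n\<ge>N. x n < a" using d K by (auto intro: order.strict_trans1)
  then show "\<forall>\<^sub>F n in sequentially. x n < a"
    by (auto simp: eventually_sequentially)
qed simp

text \<open>The left-point approximation of \<open>f\<close> on the uniform grid of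
  \<open>Suc n\<close> cells; \<open>Suc\<close> keeps the mesh meaningful for
  \<open>n = 0\<close>.\<close>

definition left_steps :: "(real \<Rightarrow> real) \<Rightarrow> real \<Rightarrow> nat \<Rightarrow> (real \<times> real \<times> real) list" where
  "left_steps f t n = map (\<lambda>i. (f (real i * t / real (Suc n)), real i * t / real (Suc n), real (Suc i) * t / real (Suc n))) [0..<Suc n]"

lemma step_fun_left_steps:
  "step_fun (left_steps f t n) s =
     (\<Sum>i<Suc n. f (real i * t / real (Suc n)) * indicator {real i * t / real (Suc n)<..real (Suc i) * t / real (Suc n)} s)"
  unfolding step_fun_def left_steps_def map_map comp_def prod.case
  by (simp only: interv_sum_list_conv_sum_set_nat set_upt lessThan_atLeast0)

lemma step_integral_left_steps:
  "step_integral B (left_steps f t n) \<omega> =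
     (\<Sum>i<Suc n. f (real i * t / real (Suc n)) * (B (real (Suc i) * t / real (Suc n)) \<omega> - B (real i * t / real (Suc n)) \<omega>))"
  unfolding step_integral_def left_steps_def map_map comp_def prod.case
  by (simp only: interv_sum_list_conv_sum_set_nat set_upt lessThan_atLeast0)

lemma steps_within_left_steps:
  assumes "0 < t" shows "steps_within t (left_steps f t n)"
proof -
  have "real (Suc i) * t / real (Suc n) \<le> t" if "i < Suc n" for i
  proof -
    have "real (Suc i) * t \<le> real (Suc n) * t"
      using that assms by (intro mult_right_mono) auto
    then show ?thesis by (simp add: divide_le_eq mult.commute)
  qed
  moreover have "real i * t / real (Suc n) \<le> real (Suc i) * t / real (Suc n)" for i
    using assms by (intro divide_right_mono mult_right_mono) auto
  ultimately show ?thesis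
    using assms unfolding steps_within_def left_steps_def by (auto simp del: upt_Suc of_nat_Suc)
qed

lemma left_steps_eq:
  assumes t: "0 < t" and s: "s \<in> {0<..t}"
  obtains u where "u \<in> {0..t}" "u \<le> s" "s - u \<le> t / Suc n" "step_fun (left_steps f t n) s = f u"
proof -
  \<comment> \<open>The cells are open on the left and closed on the right, so the index is the
    ceiling minus one; the floor would pick the wrong cell at grid points.\<close>
  define i where "i = nat (\<lceil>s * Suc n / t\<rceil> - 1)"
  have pos: "0 < s * Suc n / t" using s t by auto
  have le: "s * Suc n / t \<le> Suc n" using s t mult_right_mono[of s t "real (Suc n)"] by (simp add: divide_le_eq mult.commute del: of_nat_Suc)
  have c: "\<lceil>s * Suc n / t\<rceil> \<ge> 1" "\<lceil>s * Suc n / t\<rceil> \<le> Suc n"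
    using pos le by (simp_all add: ceiling_le_iff del: of_nat_Suc)
  have i: "real i < s * Suc n / t" "s * Suc n / t \<le> Suc i"
    unfolding i_def using c by linarith+
  have iSn: "i < Suc n" using c by (auto simp: i_def)
  have in_iff: "s \<in> {real j * t / real (Suc n)<..real (Suc j) * t / real (Suc n)} \<longleftrightarrow> j = i" for j :: nat
  proof -
    have "s \<in> {real j * t / real (Suc n)<..real (Suc j) * t / real (Suc n)} \<longleftrightarrow> real j < s * Suc n / t \<and> s * Suc n / t \<le> Suc j"
      using t by (simp add: field_simps del: of_nat_Suc)
    also have "\<dots> \<longleftrightarrow> j = i"
      using i by (auto simp del: of_nat_Suc)
    finally show ?thesis .
  qed
  have "step_fun (left_steps f t n) s = (\<Sum>j<Suc n. if j = i then f (real i * t / real (Suc n)) else 0)"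
    unfolding step_fun_left_steps
    by (intro sum.cong refl) (simp add: indicator_def in_iff del: of_nat_Suc greaterThanAtMost_iff)
  also have "\<dots> = f (real i * t / real (Suc n))" using iSn by simp
  finally have eq: "step_fun (left_steps f t n) s = f (real i * t / real (Suc n))" .
  have m: "s \<in> {real i * t / real (Suc n)<..real (Suc i) * t / real (Suc n)}" by (simp only: in_iff)
  show thesis
  proof
    show "real i * t / real (Suc n) \<le> s" using m by auto
    then show "real i * t / real (Suc n) \<in> {0..t}" using s t by auto
    show "s - real i * t / real (Suc n) \<le> t / Suc n"
      using m by (auto simp: add_divide_distrib algebra_simps)
  qed (rule eq)
qed

lemma left_steps_uniform:
  assumes t: "0 < t" and f: "continuous_on {0..t} f" and e: "0 < e"
  shows "\<exists>N. \<forall>n\<ge>N. \<forall>s\<in>{0<..t}. \<bar>f s - step_fun (left_steps f t n) s\<bar> \<le> e"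
proof -
  have "uniformly_continuous_on {0..t} f"
    using f by (intro compact_uniformly_continuous) auto
  then obtain d where d: "d > 0" "\<And>x y. x \<in> {0..t} \<Longrightarrow> y \<in> {0..t} \<Longrightarrow> dist y x < d \<Longrightarrow> dist (f y) (f x) < e"
    using e unfolding uniformly_continuous_on_def by metis
  obtain N where N: "t / d < real N" using reals_Archimedean2 by blast
  have "\<bar>f s - step_fun (left_steps f t n) s\<bar> \<le> e" if n: "n \<ge> N" and s: "s \<in> {0<..t}" for n s
  proof -
    obtain u where u: "u \<in> {0..t}" "u \<le> s" "s - u \<le> t / Suc n" "step_fun (left_steps f t n) s = f u"
      using left_steps_eq[OF t s] by blast
    have "t / d < Suc n" using N n by simp
    then have "t / Suc n < d" using d t by (simp add: field_simps)
    then have "dist (f s) (f u) < e" using u s by (intro d) (auto simp: dist_real_def)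
    then show ?thesis using u by (simp add: dist_real_def)
  qed
  then show ?thesis by blast
qed

text \<open>Only continuity of \<open>b\<close> is available, so the derivative is put on
  \<open>f\<close>. Over a cell from \<open>p\<close> to \<open>q\<close> the left-point term
  differs from the increment of \<Phi> by the integral of \<open>f' u * (b q - b u)\<close> up to
  sign, which uniform continuity of \<open>b\<close> makes small relative to \<open>q - p\<close>;
  the increments of \<Phi> telescope.\<close>

lemma left_steps_path:
  fixes f f' b :: "real \<Rightarrow> real"
  assumes t: "0 < t" and f: "\<And>u. u \<in> {0..t} \<Longrightarrow> (f has_real_derivative f' u) (at u within {0..t})"
    and f': "continuous_on {0..t} f'" and b: "continuous_on {0..t} b"
  shows "(\<lambda>n. \<Sum>i<Suc n. f (real i * t / real (Suc n)) * (b (real (Suc i) * t / real (Suc n)) - b (real i * t / real (Suc n))))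
     \<longlonglongrightarrow> f t * b t - f 0 * b 0 - integral {0..t} (\<lambda>u. f' u * b u)"
proof -
  define \<Phi> where "\<Phi> x = f x * b x - integral {0..x} (\<lambda>u. f' u * b u)" for x
  have "bounded (f' ` {0..t})"
    using f' by (intro compact_imp_bounded compact_continuous_image) auto
  then obtain C where C: "C > 0" "\<And>u. u \<in> {0..t} \<Longrightarrow> \<bar>f' u\<bar> \<le> C"
    unfolding bounded_pos by auto
  have fb: "continuous_on {0..t} (\<lambda>u. f' u * b u)" by (intro continuous_intros f' b)
  have step: "\<bar>f p * (b q - b p) - (\<Phi> q - \<Phi> p)\<bar> \<le> C * e * (q - p)"
    if pq: "0 \<le> p" "p \<le> q" "q \<le> t" and e: "\<And>u. u \<in> {p..q} \<Longrightarrow> \<bar>b q - b u\<bar> \<le> e" for p q e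
  proof -
    have e0: "e \<ge> 0" using e[of q] pq by auto
    have sub: "{p..q} \<subseteq> {0..t}" using pq by auto
    have I1: "((\<lambda>u. f' u * b u) has_integral integral {p..q} (\<lambda>u. f' u * b u)) {p..q}"
      by (intro integrable_integral integrable_continuous_interval continuous_on_subset[OF fb sub])
    have I2: "(f' has_integral f q - f p) {p..q}"
      using pq sub
      by (intro fundamental_theorem_of_calculus)
        (auto simp flip: has_real_derivative_iff_has_vector_derivative intro!: DERIV_subset[OF f])
    have "((\<lambda>u. f' u * b q - f' u * b u) has_integral
        (f q - f p) * b q - integral {p..q} (\<lambda>u. f' u * b u)) {p..q}"
      by (intro has_integral_diff has_integral_mult_left I1 I2)
    then have I: "((\<lambda>u. f' u * (b q - b u)) has_integral
        (f q - f p) * b q - integral {p..q} (\<lambda>u. f' u * b u)) {p..q}"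
      by (simp add: algebra_simps)
    have "norm (f' u * (b q - b u)) \<le> C * e" if "u \<in> {p..q}" for u
      using C(1) C(2)[of u] e[OF that] that pq e0 by (auto simp: abs_mult intro!: mult_mono)
    then have "norm ((f q - f p) * b q - integral {p..q} (\<lambda>u. f' u * b u)) \<le> C * e * Henstock_Kurzweil_Integration.content (cbox p q)"
      using C e0 I by (intro has_integral_bound[where f = "\<lambda>u. f' u * (b q - b u)"]) auto
    moreover have "integral {0..p} (\<lambda>u. f' u * b u) + integral {p..q} (\<lambda>u. f' u * b u) =
        integral {0..q} (\<lambda>u. f' u * b u)"
      using pq by (intro Henstock_Kurzweil_Integration.integral_combine
          integrable_continuous_interval continuous_on_subset[OF fb]) auto
    then have "f p * (b q - b p) - (\<Phi> q - \<Phi> p) =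
       - ((f q - f p) * b q - integral {p..q} (\<lambda>u. f' u * b u))"
      by (simp add: \<Phi>_def algebra_simps)
    ultimately show ?thesis using pq by simp
  qed
  have "(\<lambda>n. \<Sum>i<Suc n. f (real i * t / real (Suc n)) * (b (real (Suc i) * t / real (Suc n)) - b (real i * t / real (Suc n))))
     \<longlonglongrightarrow> \<Phi> t - \<Phi> 0" (is "?S \<longlonglongrightarrow> _")
  proof (rule LIMSEQ_I)
    fix r :: real assume r: "r > 0"
    \<comment> \<open>The cell errors add up to at most \<open>C * e * t\<close>, which is
      \<open>r / 2\<close> for this choice.\<close>
    define e where "e = r / (2 * C * t)"
    have e: "e > 0" using r C t by (simp add: e_def)
    have "uniformly_continuous_on {0..t} b"
      using b by (intro compact_uniformly_continuous) auto
    then obtain d where d: "d > 0" "\<And>x y. x \<in> {0..t} \<Longrightarrow> y \<in> {0..t} \<Longrightarrow> dist y x < d \<Longrightarrow> dist (b y) (b x) < e"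
      using e unfolding uniformly_continuous_on_def by metis
    obtain N where N: "t / d < real N" using reals_Archimedean2 by blast
    have "norm (?S n - (\<Phi> t - \<Phi> 0)) < r" if n: "n \<ge> N" for n
    proof -
      define g where "g i = real i * t / real (Suc n)" for i
      have g: "0 \<le> g i" "g i \<le> g (Suc i)" for i
        using t by (auto simp: g_def intro!: divide_right_mono)
      have gt: "g (Suc i) \<le> t" if "i < Suc n" for i
      proof -
        have "real (Suc i) * t \<le> real (Suc n) * t"
          using that t by (intro mult_right_mono) auto
        then show ?thesis by (simp add: g_def divide_le_eq mult.commute)
      qed
      have gd: "g (Suc i) - g i = t / Suc n" for i
        by (simp add: g_def diff_divide_distrib[symmetric] algebra_simps)
      have "t / d < Suc n" using N n by simp
      then have td: "t / Suc n < d" using d t by (simp add: field_simps)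
      have tel: "\<Phi> t - \<Phi> 0 = (\<Sum>i<Suc n. \<Phi> (g (Suc i)) - \<Phi> (g i))"
      proof -
        have "(\<Sum>i<Suc n. \<Phi> (g (Suc i)) - \<Phi> (g i)) = \<Phi> (g (Suc n)) - \<Phi> (g 0)"
          by (rule sum_lessThan_telescope)
        then show ?thesis by (simp add: g_def)
      qed
      have "\<bar>?S n - (\<Phi> t - \<Phi> 0)\<bar> =
         \<bar>\<Sum>i<Suc n. f (g i) * (b (g (Suc i)) - b (g i)) - (\<Phi> (g (Suc i)) - \<Phi> (g i))\<bar>"
        unfolding tel sum_subtractf[symmetric] by (simp only: g_def)
      also have "\<dots> \<le> (\<Sum>i<Suc n. \<bar>f (g i) * (b (g (Suc i)) - b (g i)) - (\<Phi> (g (Suc i)) - \<Phi> (g i))\<bar>)"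
        by (rule sum_abs)
      also have "\<dots> \<le> (\<Sum>i<Suc n. C * e * (g (Suc i) - g i))"
      proof (intro sum_mono step g)
        fix i assume i: "i \<in> {..<Suc n}"
        then show "g (Suc i) \<le> t" using gt by auto
        then show "\<bar>b (g (Suc i)) - b u\<bar> \<le> e" if "u \<in> {g i..g (Suc i)}" for u
          using d(2)[of u "g (Suc i)"] that g[of i] g[of "Suc i"] gd[of i] td
          by (force simp: dist_real_def)
      qed
      also have "\<dots> = C * e * t"
      proof -
        have "(\<Sum>i<Suc n. t / Suc n) = t" by simp
        then show ?thesis unfolding gd sum_distrib_left[symmetric] by simp
      qed
      also have "\<dots> < r" using r C t by (simp add: e_def)
      finally show ?thesis by simp
    qed
    then show "\<exists>N. \<forall>n\<ge>N. norm (?S n - (\<Phi> t - \<Phi> 0)) < r" by blast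
  qed
  moreover have "\<Phi> t - \<Phi> 0 = f t * b t - f 0 * b 0 - integral {0..t} (\<lambda>u. f' u * b u)"
    by (simp add: \<Phi>_def)
  ultimately show ?thesis by metis
qed

text \<open>
  The left-point sums converge to \<open>Y\<close> almost surely; they are also Cauchy in \<open>L\<^sup>2\<close> by the
  isometry, so Fatou's lemma upgrades the convergence to \<open>L\<^sup>2\<close>.
\<close>

lemma wiener_integral_by_parts:
  assumes W: "wiener_process M B" and t: "0 < t"
    and f: "\<And>u. u \<in> {0..t} \<Longrightarrow> (f has_real_derivative f' u) (at u within {0..t})"
    and f': "continuous_on {0..t} f'"
    and Y: "Y \<in> borel_measurable M"
    and eq: "AE \<omega> in M. Y \<omega> = f t * B t \<omega> - f 0 * B 0 \<omega> - integral {0..t} (\<lambda>u. f' u * B u \<omega>)"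
  shows "has_wiener_integral M B t f Y"
  unfolding has_wiener_integral_def
proof (intro conjI exI allI)
  have fc: "continuous_on {0..t} f"
    using f by (meson DERIV_continuous_on)
  show "set_borel_measurable lborel {0..t} f"
    using borel_measurable_continuous_on_indicator[OF _ fc]
    by (simp add: set_borel_measurable_def)
  show "Y \<in> borel_measurable M" by fact
  note [measurable] = Y
  let ?xs = "left_steps f t"
  show sw: "steps_within t (?xs n)" for n by (rule steps_within_left_steps[OF t])
  have [measurable]: "step_integral B (?xs n) \<in> borel_measurable M" for n
    by (rule step_integral_measurable[OF W sw])
  show "(\<lambda>n. \<integral>\<^sup>+s\<in>{0..t}. ennreal ((f s - step_fun (?xs n) s)\<^sup>2) \<partial>lborel) \<longlonglongrightarrow> 0"
  proof (rule ennreal_tendsto_0_quadratic[OF t])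
    fix e :: real assume e: "e > 0"
    obtain N where N: "\<And>n s. n \<ge> N \<Longrightarrow> s \<in> {0<..t} \<Longrightarrow> \<bar>f s - step_fun (?xs n) s\<bar> \<le> e"
      using left_steps_uniform[OF t fc e] by blast
    have "(\<integral>\<^sup>+s\<in>{0..t}. ennreal ((f s - step_fun (?xs n) s)\<^sup>2) \<partial>lborel) \<le> ennreal (t * e\<^sup>2)"
      if n: "n \<ge> N" for n
    proof -
      have "(\<integral>\<^sup>+s\<in>{0..t}. ennreal ((f s - step_fun (?xs n) s)\<^sup>2) \<partial>lborel)
          \<le> (\<integral>\<^sup>+s. ennreal (e\<^sup>2) * indicator {0..t} s \<partial>lborel)"
      proof (rule nn_integral_mono_AE)
        \<comment> \<open>At \<open>s = 0\<close> the step functions vanish while \<open>f\<close>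
          need not, so the bound is claimed only off this null set.\<close>
        show "AE s in lborel. ennreal ((f s - step_fun (?xs n) s)\<^sup>2) * indicator {0..t} s
          \<le> ennreal (e\<^sup>2) * indicator {0..t} s"
          using AE_lborel_singleton[of 0]
        proof eventually_elim
          case (elim s)
          show ?case
          proof (cases "s \<in> {0..t}")
            case True
            then have "\<bar>f s - step_fun (?xs n) s\<bar> \<le> \<bar>e\<bar>" using N[OF n, of s] elim e by auto
            then show ?thesis using True by (simp add: abs_le_square_iff ennreal_leI)
          qed simp
        qed
      qed
      also have "\<dots> = ennreal (t * e\<^sup>2)"
        using t by (subst nn_integral_cmult_indicator) (auto simp: ennreal_mult' mult.commute)
      finally show ?thesis .
    qed
    then show "\<exists>N. \<forall>n\<ge>N. (\<integral>\<^sup>+s\<in>{0..t}. ennreal ((f s - step_fun (?xs n) s)\<^sup>2) \<partial>lborel) \<le> ennreal (t * e\<^sup>2)"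
      by blast
  qed
  have "AE \<omega> in M. continuous_on {0..} (\<lambda>t. B t \<omega>)"
    using W by (simp add: wiener_process_def as_continuous_def)
  with eq have conv: "AE \<omega> in M. (\<lambda>m. step_integral B (?xs m) \<omega>) \<longlonglongrightarrow> Y \<omega>"
  proof eventually_elim
    case (elim \<omega>)
    have "continuous_on {0..t} (\<lambda>t. B t \<omega>)"
      by (rule continuous_on_subset[OF elim(2)]) auto
    from left_steps_path[OF t f f' this] show ?case
      unfolding step_integral_left_steps elim(1) by simp
  qed
  show "(\<lambda>n. \<integral>\<^sup>+\<omega>. ennreal ((Y \<omega> - step_integral B (?xs n) \<omega>)\<^sup>2) \<partial>M) \<longlonglongrightarrow> 0"
  proof (rule ennreal_tendsto_0_quadratic)
    \<comment> \<open>Two approximants within \<open>e\<close> of \<open>f\<close> are within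
      \<open>2 * e\<close> of each other; squaring and integrating over length \<open>t\<close>
      gives the factor \<open>4 * t\<close>.\<close>
    show "4 * t > 0" using t by simp
    fix e :: real assume e: "e > 0"
    obtain N where N: "\<And>n s. n \<ge> N \<Longrightarrow> s \<in> {0<..t} \<Longrightarrow> \<bar>f s - step_fun (?xs n) s\<bar> \<le> e"
      using left_steps_uniform[OF t fc e] by blast
    have sq: "(\<integral>\<^sup>+\<omega>. ennreal ((step_integral B (?xs m) \<omega> - step_integral B (?xs n) \<omega>)\<^sup>2) \<partial>M)
        \<le> ennreal (4 * t * e\<^sup>2)" if n: "n \<ge> N" and m: "m \<ge> N" for n m
    proof -
      have "(\<integral>\<^sup>+\<omega>. ennreal ((step_integral B (?xs m) \<omega> - step_integral B (?xs n) \<omega>)\<^sup>2) \<partial>M)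
         = (\<integral>\<^sup>+s. ennreal ((step_fun (?xs m) s - step_fun (?xs n) s)\<^sup>2) \<partial>lborel)"
        by (rule step_isometry_diff[OF W sw sw])
      also have "\<dots> \<le> (\<integral>\<^sup>+s. ennreal ((2 * e)\<^sup>2) * indicator {0..t} s \<partial>lborel)"
      proof (rule nn_integral_mono)
        fix s
        show "ennreal ((step_fun (?xs m) s - step_fun (?xs n) s)\<^sup>2) \<le> ennreal ((2 * e)\<^sup>2) * indicator {0..t} s"
        proof (cases "s \<in> {0<..t}")
          case True
          then have "\<bar>step_fun (?xs m) s - step_fun (?xs n) s\<bar> \<le> \<bar>2 * e\<bar>"
            using N[OF n True] N[OF m True] e by linarith
          then have "(step_fun (?xs m) s - step_fun (?xs n) s)\<^sup>2 \<le> (2 * e)\<^sup>2"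
            by (simp only: abs_le_square_iff)
          then show ?thesis using True by (simp add: ennreal_leI)
        next
          case False then show ?thesis using step_fun_outside[OF sw False] by simp
        qed
      qed
      also have "\<dots> = ennreal ((2 * e)\<^sup>2 * t)"
        using t by (subst nn_integral_cmult_indicator) (auto simp: ennreal_mult')
      also have "(2 * e)\<^sup>2 * t = 4 * t * e\<^sup>2" by (simp add: power2_eq_square)
      finally show ?thesis .
    qed
    have "(\<integral>\<^sup>+\<omega>. ennreal ((Y \<omega> - step_integral B (?xs n) \<omega>)\<^sup>2) \<partial>M) \<le> ennreal (4 * t * e\<^sup>2)"
      if n: "n \<ge> N" for n
    proof -
      have "(\<integral>\<^sup>+\<omega>. ennreal ((Y \<omega> - step_integral B (?xs n) \<omega>)\<^sup>2) \<partial>M) =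
         (\<integral>\<^sup>+\<omega>. liminf (\<lambda>m. ennreal ((step_integral B (?xs m) \<omega> - step_integral B (?xs n) \<omega>)\<^sup>2)) \<partial>M)"
      proof (rule nn_integral_cong_AE)
        show "AE \<omega> in M. ennreal ((Y \<omega> - step_integral B (?xs n) \<omega>)\<^sup>2) =
           liminf (\<lambda>m. ennreal ((step_integral B (?xs m) \<omega> - step_integral B (?xs n) \<omega>)\<^sup>2))"
          using conv
        proof eventually_elim
          case (elim \<omega>)
          have "(\<lambda>m. ennreal ((step_integral B (?xs m) \<omega> - step_integral B (?xs n) \<omega>)\<^sup>2))
             \<longlonglongrightarrow> ennreal ((Y \<omega> - step_integral B (?xs n) \<omega>)\<^sup>2)"
            by (intro tendsto_intros elim)
          from lim_imp_Liminf[OF _ this] show ?case by simp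
        qed
      qed
      also have "\<dots> \<le> liminf (\<lambda>m. \<integral>\<^sup>+\<omega>. ennreal ((step_integral B (?xs m) \<omega> - step_integral B (?xs n) \<omega>)\<^sup>2) \<partial>M)"
        by (rule nn_integral_liminf) measurable
      also have "\<dots> \<le> liminf (\<lambda>m. ennreal (4 * t * e\<^sup>2))"
        using sq[OF n] by (intro Liminf_mono) (auto simp: eventually_sequentially)
      also have "\<dots> = ennreal (4 * t * e\<^sup>2)" by (simp add: Liminf_const)
      finally show ?thesis .
    qed
    then show "\<exists>N. \<forall>n\<ge>N. (\<integral>\<^sup>+\<omega>. ennreal ((Y \<omega> - step_integral B (?xs n) \<omega>)\<^sup>2) \<partial>M) \<le> ennreal (4 * t * e\<^sup>2)"
      by blast
  qed
qed

subsection \<open>The \<open>\<alpha>\<close>-Wiener bridge as a Wiener integral\<close>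

text \<open>The equation supplies its noise term only as some version of the integral of 1; together
  with uniqueness this identifies it with the increment of \<open>B\<close>.\<close>

lemma wiener_integral_const_one:
  assumes W: "wiener_process M B" and t: "0 < t"
  shows "has_wiener_integral M B t (\<lambda>_. 1) (\<lambda>\<omega>. B t \<omega> - B 0 \<omega>)"
proof -
  have [measurable]: "B t \<in> borel_measurable M" "B 0 \<in> borel_measurable M"
    using wiener_measurable[OF W] t by auto
  show ?thesis
    by (rule wiener_integral_by_parts[OF W t, where f' = "\<lambda>_. 0"]) auto
qed

text \<open>Variation of constants for a fixed path. The path \<open>b\<close> is not
  differentiable, but the drift part \<open>D = y - b\<close> is, and
  \<open>(T - x) powr (- \<alpha>)\<close> is its integrating factor: the terms in \<open>D\<close>
  cancel in the derivative and only \<open>b\<close> remains.\<close>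

lemma alpha_ode_solution:
  fixes y b :: "real \<Rightarrow> real"
  assumes y: "continuous_on {0..<T} y" and b: "continuous_on {0..} b" and t: "0 < t" "t < T"
    and eq: "\<And>r. r \<in> {0<..<T} \<inter> \<rat> \<Longrightarrow> y r = integral {0..r} (\<lambda>u. - (\<alpha> / (T - u)) * y u) + b r"
  shows "y t = b t - integral {0..t} (\<lambda>u. (T - t) powr \<alpha> * (\<alpha> * (T - u) powr (- \<alpha> - 1)) * b u)"
proof -
  \<comment> \<open>A compact interval inside \<open>{0..<T}\<close> reaching beyond
    \<open>t\<close>, on which the singular coefficient is continuous.\<close>
  define t' where "t' = (t + T) / 2"
  have t': "t < t'" "t' < T" "0 < t'" using t by (auto simp: t'_def)
  define D where "D x = integral {0..x} (\<lambda>u. - (\<alpha> / (T - u)) * y u)" for x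
  have yc: "continuous_on {0..t'} y" and bc: "continuous_on {0..t'} b"
    using t' by (auto intro: continuous_on_subset[OF y] continuous_on_subset[OF b])
  have ac: "continuous_on {0..t'} (\<lambda>u. - (\<alpha> / (T - u)) * y u)"
    using t' by (intro continuous_intros yc) auto
  have Dc: "continuous_on {0..t'} D"
    unfolding D_def by (intro indefinite_integral_continuous_1 integrable_continuous_interval ac)
  \<comment> \<open>The equation is given at rational times only; they are dense here, so continuity
    extends it to all of \<open>{0..t'}\<close>.\<close>
  have cl: "closure ({0<..<t'} \<inter> \<rat>) = {0..t'}"
    using t' by (subst closure_open_Int_superset) (auto simp: Rats_closure_real)
  have D: "y x = D x + b x" if "x \<in> {0..t'}" for x
  proof -
    have "y x - D x - b x = 0"
    proof (rule continuous_constant_on_closure[where S = "{0<..<t'} \<inter> \<rat>" and f = "\<lambda>x. y x - D x - b x"])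
      show "continuous_on (closure ({0<..<t'} \<inter> \<rat>)) (\<lambda>x. y x - D x - b x)"
        unfolding cl by (intro continuous_intros yc bc Dc)
      show "\<And>x. x \<in> {0<..<t'} \<inter> \<rat> \<Longrightarrow> y x - D x - b x = 0"
        using eq t' by (auto simp: D_def)
      show "x \<in> closure ({0<..<t'} \<inter> \<rat>)" using that by (simp only: cl)
    qed
    then show ?thesis by simp
  qed
  have "((\<lambda>x. (T - x) powr (- \<alpha>) * D x) has_real_derivative - (\<alpha> * (T - x) powr (- \<alpha> - 1) * b x))
      (at x within {0..t})" if x: "x \<in> {0..t}" for x
  proof -
    have xT: "T - x > 0" using x t by auto
    have "(D has_real_derivative - (\<alpha> / (T - x)) * y x) (at x within {0..t'})"
      unfolding D_def using x t' by (intro integral_has_real_derivative ac) auto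
    then have "(D has_real_derivative - (\<alpha> / (T - x)) * y x) (at x within {0..t})"
      using t' by (auto intro: DERIV_subset)
    then have "((\<lambda>x. (T - x) powr (- \<alpha>) * D x) has_real_derivative
        \<alpha> * (T - x) powr (- \<alpha> - 1) * D x + (- (\<alpha> / (T - x)) * y x) * (T - x) powr (- \<alpha>))
      (at x within {0..t})"
      using xT by (auto intro!: derivative_eq_intros)
    also have "\<alpha> * (T - x) powr (- \<alpha> - 1) * D x + (- (\<alpha> / (T - x)) * y x) * (T - x) powr (- \<alpha>) =
        - (\<alpha> * (T - x) powr (- \<alpha> - 1) * b x)"
    proof -
      have identity: "a * (P / w) * d + (- (a / w) * (d + c)) * P = - (a * (P / w) * c)" for a P w d c :: real
        by (simp add: algebra_simps add_divide_distrib)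
      have p: "(T - x) powr (- \<alpha> - 1) = (T - x) powr (- \<alpha>) / (T - x)"
        using xT by (simp add: powr_diff)
      have "y x = D x + b x" using D x t' by simp
      then show ?thesis unfolding p by (simp only: identity)
    qed
    finally show ?thesis .
  qed
  then have "((\<lambda>x. - (\<alpha> * (T - x) powr (- \<alpha> - 1) * b x)) has_integral
      (T - t) powr (- \<alpha>) * D t - (T - 0) powr (- \<alpha>) * D 0) {0..t}"
    using t by (intro fundamental_theorem_of_calculus)
      (auto simp flip: has_real_derivative_iff_has_vector_derivative)
  from has_integral_mult_right[OF this, of "(T - t) powr \<alpha>"]
  have "((\<lambda>x. (T - t) powr \<alpha> * - (\<alpha> * (T - x) powr (- \<alpha> - 1) * b x)) has_integral
      (T - t) powr \<alpha> * ((T - t) powr (- \<alpha>) * D t)) {0..t}"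
    by (simp add: D_def)
  then have "((\<lambda>x. - ((T - t) powr \<alpha> * (\<alpha> * (T - x) powr (- \<alpha> - 1)) * b x)) has_integral D t) {0..t}"
    using t by (simp add: powr_minus field_simps)
  from has_integral_neg[OF this]
  have "integral {0..t} (\<lambda>u. (T - t) powr \<alpha> * (\<alpha> * (T - u) powr (- \<alpha> - 1)) * b u) = - D t"
    by (simp add: integral_unique)
  then show ?thesis using D[of t] t t' by simp
qed

text \<open>The pathwise solution is the integration by parts formula of this kernel: the kernel
  equals 1 at \<open>u = t\<close>, its derivative is the weight of \<open>B\<close> under the
  integral, and the term at 0 vanishes with \<open>B 0\<close>.\<close>

lemma alpha_wiener_bridge_wiener_integral:
  assumes W: "wiener_process M B"
    and Y: "strong_solution M B {0..<T} (\<lambda>t. - (\<alpha> / (T - t))) (\<lambda>_. 1) Y"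
    and Y0: "AE \<omega> in M. Y 0 \<omega> = 0" and t: "0 < t" "t < T"
  shows "has_wiener_integral M B t (\<lambda>u. (T - t) powr \<alpha> * (T - u) powr (- \<alpha>)) (Y t)"
proof (rule wiener_integral_by_parts[OF W t(1), where f' = "\<lambda>u. (T - t) powr \<alpha> * (\<alpha> * (T - u) powr (- \<alpha> - 1))"])
  show "((\<lambda>u. (T - t) powr \<alpha> * (T - u) powr (- \<alpha>)) has_real_derivative
        (T - t) powr \<alpha> * (\<alpha> * (T - u) powr (- \<alpha> - 1))) (at u within {0..t})" if "u \<in> {0..t}" for u
    using that t by (auto intro!: derivative_eq_intros)
  show "continuous_on {0..t} (\<lambda>u. (T - t) powr \<alpha> * (\<alpha> * (T - u) powr (- \<alpha> - 1)))"
    using t by (intro continuous_intros) auto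
  show "Y t \<in> borel_measurable M"
    using Y t by (auto simp: strong_solution_def stochastic_process_def)
  have Yr: "AE \<omega> in M. Y r \<omega> = Y 0 \<omega> + integral {0..r} (\<lambda>u. - (\<alpha> / (T - u)) * Y u \<omega>) + (B r \<omega> - B 0 \<omega>)"
    if r: "r \<in> {0<..<T} \<inter> \<rat>" for r
  proof -
    obtain V where V: "has_wiener_integral M B r (\<lambda>_. 1) V"
       "AE \<omega> in M. Y r \<omega> = Y 0 \<omega> + integral {0..r} (\<lambda>u. - (\<alpha> / (T - u)) * Y u \<omega>) + V \<omega>"
      using Y r unfolding strong_solution_def by force
    have "AE \<omega> in M. V \<omega> = B r \<omega> - B 0 \<omega>"
      using r by (intro has_wiener_integral_unique[OF W V(1)] wiener_integral_const_one[OF W]) auto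
    with V(2) show ?thesis by eventually_elim simp
  qed
  \<comment> \<open>The exceptional null set of the equation depends on the time; countably many
    times share a single one.\<close>
  have "AE \<omega> in M. \<forall>r\<in>{0<..<T} \<inter> \<rat>.
      Y r \<omega> = Y 0 \<omega> + integral {0..r} (\<lambda>u. - (\<alpha> / (T - u)) * Y u \<omega>) + (B r \<omega> - B 0 \<omega>)"
    by (subst AE_ball_countable) (use Yr countable_rat in \<open>auto intro: countable_subset\<close>)
  moreover have "AE \<omega> in M. continuous_on {0..<T} (\<lambda>t. Y t \<omega>)"
    using Y by (simp add: strong_solution_def as_continuous_def)
  moreover have "AE \<omega> in M. continuous_on {0..} (\<lambda>t. B t \<omega>)" "AE \<omega> in M. B 0 \<omega> = 0"
    using W by (simp_all add: wiener_process_def as_continuous_def)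
  ultimately show "AE \<omega> in M. Y t \<omega> = (T - t) powr \<alpha> * (T - t) powr (- \<alpha>) * B t \<omega>
      - (T - t) powr \<alpha> * (T - 0) powr (- \<alpha>) * B 0 \<omega>
      - integral {0..t} (\<lambda>u. (T - t) powr \<alpha> * (\<alpha> * (T - u) powr (- \<alpha> - 1)) * B u \<omega>)"
    using Y0
  proof eventually_elim
    case (elim \<omega>)
    have "Y t \<omega> = B t \<omega> - integral {0..t} (\<lambda>u. (T - t) powr \<alpha> * (\<alpha> * (T - u) powr (- \<alpha> - 1)) * B u \<omega>)"
      by (rule alpha_ode_solution[OF elim(2,3) t]) (use elim in auto)
    then show ?case using t elim by (simp add: powr_minus)
  qed
qed

subsection \<open>Comparison of covariances\<close>

text \<open>The product is a function of the marginal on \<open>{s, t}\<close>. The case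
  \<open>s = t\<close> is covered, with a one-point index set.\<close>

lemma same_fdd_product_moment:
  assumes fdd: "same_fdd I M X N Y" and st: "s \<in> I" "t \<in> I"
    and [measurable]: "X s \<in> borel_measurable M" "X t \<in> borel_measurable M"
      "Y s \<in> borel_measurable N" "Y t \<in> borel_measurable N"
  shows "(\<integral>\<omega>. X s \<omega> * X t \<omega> \<partial>M) = (\<integral>\<omega>. Y s \<omega> * Y t \<omega> \<partial>N)"
proof -
  let ?P = "Pi\<^sub>M {s, t} (\<lambda>_. borel) :: (real \<Rightarrow> real) measure"
  have m: "(\<lambda>\<omega>. \<lambda>r\<in>{s, t}. X r \<omega>) \<in> M \<rightarrow>\<^sub>M ?P" "(\<lambda>\<omega>. \<lambda>r\<in>{s, t}. Y r \<omega>) \<in> N \<rightarrow>\<^sub>M ?P"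
    by (rule measurable_restrict; auto)+
  have p: "(\<lambda>x. x s * x t) \<in> borel_measurable ?P"
    by (intro borel_measurable_times measurable_component_singleton) auto
  have "(\<integral>\<omega>. X s \<omega> * X t \<omega> \<partial>M) = (\<integral>x. x s * x t \<partial>distr M ?P (\<lambda>\<omega>. \<lambda>r\<in>{s, t}. X r \<omega>))"
    by (subst integral_distr[OF m(1) p]) simp
  also have "distr M ?P (\<lambda>\<omega>. \<lambda>r\<in>{s, t}. X r \<omega>) = distr N ?P (\<lambda>\<omega>. \<lambda>r\<in>{s, t}. Y r \<omega>)"
    using fdd st by (simp add: same_fdd_def)
  also have "(\<integral>x. x s * x t \<partial>\<dots>) = (\<integral>\<omega>. Y s \<omega> * Y t \<omega> \<partial>N)"
    by (subst integral_distr[OF m(2) p]) simp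
  finally show ?thesis .
qed

text \<open>For \<open>s \<le> t\<close> the two indicators multiply to that of
  \<open>{0..s}\<close>, so \<open>t\<close> enters only through \<open>h t\<close>.\<close>

lemma wiener_integral_separable_moment:
  assumes W: "wiener_process M B" and st: "s \<le> t"
    and V: "has_wiener_integral M B s (\<lambda>u. h s * k u) V"
    and Y: "has_wiener_integral M B t (\<lambda>u. h t * k u) Y"
  shows "(\<integral>\<omega>. V \<omega> * Y \<omega> \<partial>M) = h s * h t * (\<integral>u. indicator {0..s} u * (k u)\<^sup>2 \<partial>lborel)"
proof -
  have "(\<integral>\<omega>. V \<omega> * Y \<omega> \<partial>M) = (\<integral>u. h s * h t * (indicator {0..s} u * (k u)\<^sup>2) \<partial>lborel)"
    unfolding wiener_integral_isometry(2)[OF W V Y]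
    by (intro Bochner_Integration.integral_cong)
      (use st in \<open>auto simp: indicator_def power2_eq_square\<close>)
  then show ?thesis by simp
qed

lemma integral_Icc_pos:
  fixes g :: "real \<Rightarrow> real"
  assumes s: "0 < s" and g: "continuous_on {0..s} g" and pos: "\<And>u. u \<in> {0..s} \<Longrightarrow> 0 < g u"
  shows "0 < (\<integral>u. indicator {0..s} u * g u \<partial>lborel)"
proof -
  have i: "integrable lborel (\<lambda>u. indicator {0..s} u * g u)"
    using borel_integrable_atLeastAtMost'[OF g] by (simp add: set_integrable_def)
  have nn: "0 \<le> indicator {0..s} u * g u" for u
    using pos[of u] by (auto simp: indicator_def)
  have "(\<integral>u. indicator {0..s} u * g u \<partial>lborel) \<noteq> 0"
  proof
    assume "(\<integral>u. indicator {0..s} u * g u \<partial>lborel) = 0"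
    then have "AE u in lborel. indicator {0..s} u * g u = 0"
      using integral_nonneg_eq_0_iff_AE[OF i] nn by auto
    then have "AE u in lborel. u \<notin> {0..s}"
      by eventually_elim (use pos in \<open>force simp: indicator_def split: if_splits\<close>)
    then have "emeasure lborel {0..s} = 0"
      by (subst (asm) AE_iff_measurable[where N = "{0..s}"]) auto
    then show False using s by simp
  qed
  moreover have "0 \<le> (\<integral>u. indicator {0..s} u * g u \<partial>lborel)"
    by (intro Bochner_Integration.integral_nonneg nn)
  ultimately show ?thesis by simp
qed

section \<open>Behaviour at the terminal time\<close>

lemma continuous_on_qbar:
  assumes "continuous_on {0..} q" shows "continuous_on {0..T} (qbar q)"
  unfolding qbar_def
  by (intro indefinite_integral_continuous_1 integrable_continuous_interval continuous_on_subset[OF assms]) auto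

lemma at_left_eq_within_Icc:
  fixes T :: real
  assumes "0 < T" shows "at T within {0..T} = at_left T"
  using assms by (intro at_within_nhd[where S = "{0<..}"]) auto

text \<open>The quotient is the difference quotient at \<open>T\<close> of the indefinite integral
  of \<phi>, and in \<open>\<phi> T\<close> the exponential factor is 1.\<close>

lemma ou_gamma_quotient_tendsto:
  assumes q: "continuous_on {0..} q" and \<sigma>: "continuous_on {0..} \<sigma>" and T: "0 < T"
  shows "((\<lambda>t. ou_gamma q \<sigma> t T / (T - t)) \<longlongrightarrow> (\<sigma> T)\<^sup>2) (at_left T)"
proof -
  define \<phi> where "\<phi> u = exp (2 * (qbar q T - qbar q u)) * (\<sigma> u)\<^sup>2" for u
  have \<phi>: "continuous_on {0..T} \<phi>"
    unfolding \<phi>_def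
    by (intro continuous_intros continuous_on_qbar[OF q] continuous_on_subset[OF \<sigma>]) auto
  have "((\<lambda>t. integral {0..t} \<phi>) has_real_derivative \<phi> T) (at T within {0..T})"
    using T by (intro integral_has_real_derivative \<phi>) auto
  then have "((\<lambda>t. (integral {0..t} \<phi> - integral {0..T} \<phi>) / (t - T)) \<longlongrightarrow> \<phi> T) (at_left T)"
    by (simp add: has_field_derivative_iff at_left_eq_within_Icc[OF T])
  moreover have "\<forall>\<^sub>F t in at_left T. (integral {0..t} \<phi> - integral {0..T} \<phi>) / (t - T) = ou_gamma q \<sigma> t T / (T - t)"
    using eventually_at_left_real[OF T]
  proof eventually_elim
    case (elim t)
    have "integral {0..t} \<phi> + integral {t..T} \<phi> = integral {0..T} \<phi>"
      using elim by (intro Henstock_Kurzweil_Integration.integral_combine integrable_continuous_interval \<phi>) auto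
    then have "integral {0..t} \<phi> - integral {0..T} \<phi> = - ou_gamma q \<sigma> t T"
      by (simp add: ou_gamma_def \<phi>_def[abs_def])
    moreover have "t - T = - (T - t)" by simp
    ultimately show ?case by (simp only: minus_divide_divide)
  qed
  moreover have "\<phi> T = (\<sigma> T)\<^sup>2" by (simp add: \<phi>_def)
  ultimately show ?thesis by (simp add: tendsto_cong)
qed

lemma powr_distance_tendsto_0:
  fixes T \<beta> :: real
  assumes "0 < \<beta>"
  shows "((\<lambda>t. (T - t) powr \<beta>) \<longlongrightarrow> 0) (at_left T)"
proof -
  have "((\<lambda>t. (T - t) powr \<beta>) \<longlongrightarrow> (T - T) powr \<beta>) (at_left T)"
    using assms by (intro tendsto_powr' tendsto_intros) (auto simp: eventually_at_filter)
  then show ?thesis by simp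
qed

text \<open>After division by \<open>T - t\<close> the left side of the relation has the finite
  limit \<open>c * L\<close>, the right side is \<open>d * (T - t) powr (\<alpha> - 1)\<close>. If
  \<alpha> > 1 the latter tends to 0, so \<open>c = 0\<close>, and the relation at
  \<open>T / 2\<close> gives \<open>d = 0\<close>.\<close>

lemma no_power_decay:
  fixes h :: "real \<Rightarrow> real"
  assumes T: "0 < T" and \<alpha>: "\<alpha> \<noteq> 1" and L: "L \<noteq> 0"
    and h: "((\<lambda>t. h t / (T - t)) \<longlongrightarrow> L) (at_left T)"
    and eq: "\<And>t. T / 2 \<le> t \<Longrightarrow> t < T \<Longrightarrow> c * h t = d * (T - t) powr \<alpha>" and d: "d \<noteq> 0"
  shows False
proof -
  have lim: "((\<lambda>t. c * (h t / (T - t))) \<longlongrightarrow> c * L) (at_left T)"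
    by (intro tendsto_intros h)
  have ev: "\<forall>\<^sub>F t in at_left T. t \<in> {T / 2<..<T}"
    using T by (intro eventually_at_left_real) auto
  then have ev: "\<forall>\<^sub>F t in at_left T. T / 2 < t \<and> t < T \<and> c * (h t / (T - t)) = d * (T - t) powr (\<alpha> - 1)"
  proof eventually_elim
    case (elim t)
    then show ?case using eq[of t] by (auto simp: powr_diff field_simps)
  qed
  show False
  proof (cases "\<alpha> > 1")
    case True
    have "((\<lambda>t. d * (T - t) powr (\<alpha> - 1)) \<longlongrightarrow> d * 0) (at_left T)"
      using True by (intro tendsto_intros powr_distance_tendsto_0) auto
    then have "((\<lambda>t. c * (h t / (T - t))) \<longlongrightarrow> d * 0) (at_left T)"
      by (rule Lim_transform_eventually) (use ev in eventually_elim, auto)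
    then have "c * L = d * 0"
      using lim by (intro tendsto_unique[of "at_left T"]) auto
    then have "c = 0" using L by simp
    then show False using eq[of "T / 2"] T d by auto
  next
    case False
    \<comment> \<open>Here the power blows up; multiplying by its reciprocal keeps all limits finite
      and leaves the constant \<open>d\<close>, which must then be 0.\<close>
    then have "((\<lambda>t. (T - t) powr (1 - \<alpha>) * (c * (h t / (T - t)))) \<longlongrightarrow> 0 * (c * L)) (at_left T)"
      using \<alpha> by (intro tendsto_mult lim powr_distance_tendsto_0) auto
    moreover have "\<forall>\<^sub>F t in at_left T. (T - t) powr (1 - \<alpha>) * (c * (h t / (T - t))) = d"
      using ev by eventually_elim (simp add: powr_add[symmetric] mult.left_commute)
    ultimately have "((\<lambda>t. d) \<longlongrightarrow> 0 * (c * L)) (at_left T)"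
      by (rule Lim_transform_eventually)
    then show False using d by (simp add: tendsto_const_iff)
  qed
qed

theorem corollary4p3:
  fixes T \<alpha> :: real
    and M' :: "'c measure" and B' :: "real \<Rightarrow> 'c \<Rightarrow> real"
    and N' :: "'d measure" and X :: "real \<Rightarrow> 'd \<Rightarrow> real"
  assumes "T > 0" and "\<alpha> \<noteq> 1"
    and "alpha_wiener_bridge \<alpha> T M' B' N' X"
  shows "\<not> (\<exists>q \<sigma> (M :: 'a measure) B Z (N :: 'b measure) U.
            ou_type_process q \<sigma> M B Z \<and>
            ou_bridge q \<sigma> M B T N U \<and>
            same_fdd {0..<T} N U N' X)"
proof (intro notI, elim exE conjE)
  fix q \<sigma> B Z U and M :: "'a measure" and N :: "'b measure"
  assume Z: "ou_type_process q \<sigma> M B Z" and U: "ou_bridge q \<sigma> M B T N U"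
    and UX: "same_fdd {0..<T} N U N' X"
  have q: "continuous_on {0..} q" and \<sigma>: "continuous_on {0..} \<sigma>" and \<sigma>0: "\<sigma> T \<noteq> 0"
    and W: "wiener_process M B"
    using Z \<open>T > 0\<close> by (auto simp: ou_type_process_def)
  obtain V where V: "\<And>t. t \<in> {0..<T} \<Longrightarrow> has_wiener_integral M B t
        (\<lambda>s. ou_gamma q \<sigma> t T / ou_gamma q \<sigma> s T * exp (qbar q t - qbar q s) * \<sigma> s) (V t)"
      and VU: "same_fdd {0..T} M V N U"
    using U unfolding ou_bridge_def by blast
  have W': "wiener_process M' B'"
    using assms(3) by (simp add: alpha_wiener_bridge_def)
  obtain Y where Y: "strong_solution M' B' {0..<T} (\<lambda>t. - (\<alpha> / (T - t))) (\<lambda>_. 1) Y"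
      "AE \<omega> in M'. Y 0 \<omega> = 0" and YX: "same_fdd {0..<T} M' Y N' X"
    using assms(3) unfolding alpha_wiener_bridge_def by blast
  have mV: "V t \<in> borel_measurable M" if "t \<in> {0..<T}" for t
    using V[OF that] by (simp add: has_wiener_integral_def)
  have mU: "U t \<in> borel_measurable N" if "t \<in> {0..<T}" for t
    using U that by (auto simp: ou_bridge_def stochastic_process_def)
  have mX: "X t \<in> borel_measurable N'" if "t \<in> {0..<T}" for t
    using assms(3) that by (auto simp: alpha_wiener_bridge_def stochastic_process_def)
  have mY: "Y t \<in> borel_measurable M'" if "t \<in> {0..<T}" for t
    using Y(1) that by (auto simp: strong_solution_def stochastic_process_def)
  \<comment> \<open>The kernel of the bridge is split into a factor in \<open>t\<close> and a factor
    in \<open>u\<close>, the form in which the covariance separates.\<close>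
  define h where "h t = ou_gamma q \<sigma> t T * exp (qbar q t)" for t
  define k where "k u = exp (- qbar q u) * \<sigma> u / ou_gamma q \<sigma> u T" for u
  define s where "s = T / 2"
  define K where "K = (\<integral>u. indicator {0..s} u * (k u)\<^sup>2 \<partial>lborel)"
  define K' where "K' = (\<integral>u. indicator {0..s} u * ((T - u) powr (- \<alpha>))\<^sup>2 \<partial>lborel)"
  have s: "0 < s" "s < T" using \<open>T > 0\<close> by (auto simp: s_def)
  have Vk: "has_wiener_integral M B t (\<lambda>u. h t * k u) (V t)" if "t \<in> {0..<T}" for t
    using V[OF that] by (simp add: h_def k_def exp_diff exp_minus field_simps)
  have eq: "(K * h s) * h t = ((T - s) powr \<alpha> * K') * (T - t) powr \<alpha>" if t: "s \<le> t" "t < T" for t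
  proof -
    have st: "s \<in> {0..<T}" "t \<in> {0..<T}" using s t by auto
    have "h s * h t * K = (\<integral>\<omega>. V s \<omega> * V t \<omega> \<partial>M)"
      unfolding K_def by (rule wiener_integral_separable_moment[OF W t(1) Vk Vk, symmetric]) (use st in auto)
    also have "\<dots> = (\<integral>\<omega>. U s \<omega> * U t \<omega> \<partial>N)"
      by (rule same_fdd_product_moment[OF VU]) (use st mV mU in auto)
    also have "\<dots> = (\<integral>\<omega>. X s \<omega> * X t \<omega> \<partial>N')"
      by (rule same_fdd_product_moment[OF UX]) (use st mX mU in auto)
    also have "\<dots> = (\<integral>\<omega>. Y s \<omega> * Y t \<omega> \<partial>M')"
      by (rule same_fdd_product_moment[OF YX, symmetric]) (use st mX mY in auto)
    also have "\<dots> = (T - s) powr \<alpha> * (T - t) powr \<alpha> * K'"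
      unfolding K'_def
      by (rule wiener_integral_separable_moment[OF W' t(1), where h = "\<lambda>t. (T - t) powr \<alpha>"];
          rule alpha_wiener_bridge_wiener_integral[OF W' Y]) (use s t in auto)
    finally show ?thesis by (simp add: mult_ac)
  qed
  \<comment> \<open>On \<open>{0..s}\<close> the integrand stays away from the singularity at
    \<open>T\<close>, so it is continuous and positive; this makes the constant on the right of
    \<open>eq\<close> nonzero.\<close>
  have "0 < K'"
    unfolding K'_def using s by (intro integral_Icc_pos continuous_intros) auto
  then have d: "(T - s) powr \<alpha> * K' \<noteq> 0" using s by simp
  have "(qbar q \<longlongrightarrow> qbar q T) (at_left T)"
    using continuous_on_qbar[OF q, of T] \<open>T > 0\<close>
    by (auto simp: continuous_on_def simp flip: at_left_eq_within_Icc[OF \<open>T > 0\<close>])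
  then have "((\<lambda>t. ou_gamma q \<sigma> t T / (T - t) * exp (qbar q t)) \<longlongrightarrow> (\<sigma> T)\<^sup>2 * exp (qbar q T)) (at_left T)"
    by (intro tendsto_intros ou_gamma_quotient_tendsto[OF q \<sigma> \<open>T > 0\<close>])
  then have "((\<lambda>t. h t / (T - t)) \<longlongrightarrow> (\<sigma> T)\<^sup>2 * exp (qbar q T)) (at_left T)"
    by (simp add: h_def)
  then show False
    by (rule no_power_decay[OF \<open>T > 0\<close> \<open>\<alpha> \<noteq> 1\<close> _ _ eq[unfolded s_def] d[unfolded s_def], rotated])
      (use \<sigma>0 in auto)
qed

end
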